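(* There exists an absolute constant $C>0$ such that the following holds. Let $d\in\mathbb{N}$, let $\kappa:(0,+\infty)\to[1,+\infty)$ be an increasing function such that for every $0<\epsilon\le 1/2$ there is a positive number $N_{\kappa,\epsilon}$ with $\kappa(N_{\kappa,\epsilon})\ge 1/\epsilon$ (fix such a choice), and let $f\in\mathcal{A}_\kappa$ with $\|f\|_{\mathcal{A}_\kappa}\le 1$. Let $n>2$, $0<\sigma\le 1/10$, $0<\epsilon<\sigma/n$, $B=\lceil 4n/\sigma\rceil$, $r=B\sqrt{\log(1/\epsilon)}$, $L=\lceil r\sqrt{2\log(1/\epsilon)}\rceil$, and let $N\ge\max\{\lceil N_{\kappa,\epsilon}\rceil,3L\}$ be a prime number. Then: (1) with probability at least $1-\sigma$ over the randomness of $\boldsymbol{H}_N$ and $\boldsymbol{z}$, $$\big|I(f)_{\boldsymbol{H}_N,L,r,\boldsymbol{z}}-\operatorname{INT}(f)\big|\le C\Big(\frac{\log(1/\epsilon)}{L\sigma}+\epsilon\Big).$$ (2) Let $t\ge 7$ be an odd integer and let $Y={\rm median}\{I(f)_{\boldsymbol{H}_{N_j},L,r,\boldsymbol{z}_j}\}_{j=1}^t$, where $(\boldsymbol{H}_{N_j},\boldsymbol{z}_j)$, $1\le j\le t$, are $t$ independent copies of $(\boldsymbol{H}_N,\boldsymbol{z})$. Then with probability at least $1-(2\sqrt{\sigma})^t$, $$|Y-\operatorname{INT}(f)|\le C\Big(\frac{\log(1/\epsilon)}{L\sigma}+\epsilon\Big).$$ (3) With $t$ and $Y$ as in (2), $$\Big(\mathbb{E}\,|Y-\operatorname{INT}(f)|^2\Big)^{1/2}\le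 C\Big(\frac{\log(1/\epsilon)}{L\sigma}+\epsilon+(2\sqrt{\sigma})^t\Big).$$
   Context: $\log$ is the natural logarithm; an absolute constant depends on nothing (in particular not on $d$ or $\kappa$). $\mathcal{T}=\mathbb{R}/\mathbb{Z}=[0,1)$; $\operatorname{INT}(f)=\int_{[0,1]^d}f(\boldsymbol{x})\,d\boldsymbol{x}$; $\hat f(\boldsymbol{k})=\int_{[0,1]^d}f(\boldsymbol{x})e^{-2\pi i\boldsymbol{k}\cdot\boldsymbol{x}}d\boldsymbol{x}$. For $\boldsymbol{k}\in\mathbb{Z}^d$, $\operatorname{supp}(\boldsymbol{k})=\{j:k_j\ne 0\}$. Subspace of the Wiener algebra: $\mathcal{A}_\kappa$ is the set of continuous $f:\mathcal{T}^d\to\mathbb{C}$ with $$\|f\|_{\mathcal{A}_\kappa}:=|\hat f(\boldsymbol{0})|+\sum_{\boldsymbol{k}\in\mathbb{Z}^d\setminus\{\boldsymbol{0}\}}\Big|\hat f(\boldsymbol{k})\,\kappa\Big(\min_{j\in\operatorname{supp}(\boldsymbol{k})}|k_j|\Big)\Big|<\infty .$$ Quadrature: $$I(f)_{\boldsymbol{H}_N,L,r,\boldsymbol{z}}:=\sum_{l\in\mathbb{Z},|l|\le L}f\Big(\Big\{\frac{\boldsymbol{z}-l\boldsymbol{H}_N}{N}\Big\}\Big)G_{r,l},\qquad G_{r,l}=\frac{1}{r\sqrt{2\pi}}\exp\Big(-\frac{l^2}{2r^2}\Big),$$ where $\{\cdot\}$ is the componentwise fractional part in $[0,1)$, and $\boldsymbol{H}_N$,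 $\boldsymbol{z}$ are independent and uniform on $\mathbb{Z}^d\cap[1,N)^d$ and $\mathbb{Z}^d\cap[0,N)^d$ respectively. The median of complex numbers is the median of the real parts plus $i$ times the median of the imaginary parts. *)

theory Defs
  imports "HOL-Probability.Probability" "HOL-Computational_Algebra.Primes"
begin

text \<open>
  The constant in the theorem must not depend on the dimension, so the dimension is a natural
  number \<open>d\<close> and not a type: vectors in \<open>\<real>\<^sup>d\<close> and \<open>\<int>\<^sup>d\<close> are the extensional functions on
  \<open>{..<d}\<close>.
\<close>

definition RVec :: "nat \<Rightarrow> (nat \<Rightarrow> real) set" where
  "RVec d = (\<Pi>\<^sub>E j\<in>{..<d}. UNIV)"

definition ZVec :: "nat \<Rightarrow> (nat \<Rightarrow> int) set" where
  "ZVec d = (\<Pi>\<^sub>E j\<in>{..<d}. UNIV)"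

definition zero_vec :: "nat \<Rightarrow> nat \<Rightarrow> int" where
  "zero_vec d = (\<lambda>j\<in>{..<d}. 0)"

definition supp :: "nat \<Rightarrow> (nat \<Rightarrow> int) \<Rightarrow> nat set" where
  "supp d k = {j. j < d \<and> k j \<noteq> 0}"

definition unit_cube :: "nat \<Rightarrow> (nat \<Rightarrow> real) set" where
  "unit_cube d = (\<Pi>\<^sub>E j\<in>{..<d}. {0..1})"

abbreviation lebesgue_vec :: "nat \<Rightarrow> (nat \<Rightarrow> real) measure" where
  "lebesgue_vec d \<equiv> (\<Pi>\<^sub>M j\<in>{..<d}. lborel)"

text \<open>
  Continuous functions on the torus \<open>(\<real>/\<int>)\<^sup>d\<close> are represented by the continuous functions on
  \<open>\<real>\<^sup>d\<close> that have period 1 in each coordinate. Values outside of \<open>RVec d\<close> are irrelevant.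
\<close>

definition continuous_torus :: "nat \<Rightarrow> ((nat \<Rightarrow> real) \<Rightarrow> complex) \<Rightarrow> bool" where
  "continuous_torus d f \<longleftrightarrow>
     continuous_map (product_topology (\<lambda>_. euclideanreal) {..<d}) euclidean f \<and>
     (\<forall>x\<in>RVec d. \<forall>j<d. f (x(j := x j + 1)) = f x)"

definition INT_f :: "nat \<Rightarrow> ((nat \<Rightarrow> real) \<Rightarrow> complex) \<Rightarrow> complex" where
  "INT_f d f = (LINT x:unit_cube d|lebesgue_vec d. f x)"

definition fourier_coeff :: "nat \<Rightarrow> ((nat \<Rightarrow> real) \<Rightarrow> complex) \<Rightarrow> (nat \<Rightarrow> int) \<Rightarrow> complex" where
  "fourier_coeff d f k =
     (LINT x:unit_cube d|lebesgue_vec d.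
        f x * exp (- (2 * complex_of_real pi * \<i> *
                      complex_of_real (\<Sum>j<d. real_of_int (k j) * x j))))"

definition A_term ::
    "nat \<Rightarrow> (real \<Rightarrow> real) \<Rightarrow> ((nat \<Rightarrow> real) \<Rightarrow> complex) \<Rightarrow> (nat \<Rightarrow> int) \<Rightarrow> real" where
  "A_term d \<kappa> f k =
     cmod (fourier_coeff d f k *
           complex_of_real (\<kappa> (real_of_int (Min ((\<lambda>j. \<bar>k j\<bar>) ` supp d k)))))"

text \<open>
  Since the terms are non-negative, summability in \<open>A_space\<close> says exactly that the (possibly
  infinite) series in the norm is finite; \<open>A_norm\<close> is only meaningful on \<open>A_space\<close>.
\<close>

definition A_norm :: "nat \<Rightarrow> (real \<Rightarrow> real) \<Rightarrow> ((nat \<Rightarrow> real) \<Rightarrow> complex) \<Rightarrow> real" where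
  "A_norm d \<kappa> f =
     cmod (fourier_coeff d f (zero_vec d)) + infsum (A_term d \<kappa> f) (ZVec d - {zero_vec d})"

definition A_space :: "nat \<Rightarrow> (real \<Rightarrow> real) \<Rightarrow> ((nat \<Rightarrow> real) \<Rightarrow> complex) set" where
  "A_space d \<kappa> = {f. continuous_torus d f \<and> A_term d \<kappa> f summable_on (ZVec d - {zero_vec d})}"

definition gauss_weight :: "real \<Rightarrow> int \<Rightarrow> real" where
  "gauss_weight r l = 1 / (r * sqrt (2 * pi)) * exp (- ((real_of_int l)\<^sup>2 / (2 * r\<^sup>2)))"

definition quad ::
    "nat \<Rightarrow> ((nat \<Rightarrow> real) \<Rightarrow> complex) \<Rightarrow> nat \<Rightarrow> int \<Rightarrow> real \<Rightarrow> (nat \<Rightarrow> int) \<times> (nat \<Rightarrow> int) \<Rightarrow> complex"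
  where
  "quad d f N L r = (\<lambda>(H, z).
     \<Sum>l\<in>{-L..L}. f (\<lambda>j\<in>{..<d}. frac (real_of_int (z j - l * H j) / real N)) *
                   complex_of_real (gauss_weight r l))"

text \<open>The joint law of the pair \<open>(H\<^sub>N, z)\<close>.\<close>

definition Hz_pmf :: "nat \<Rightarrow> nat \<Rightarrow> ((nat \<Rightarrow> int) \<times> (nat \<Rightarrow> int)) pmf" where
  "Hz_pmf d N = pair_pmf (pmf_of_set (\<Pi>\<^sub>E j\<in>{..<d}. {1..<int N}))
                         (pmf_of_set (\<Pi>\<^sub>E j\<in>{..<d}. {0..<int N}))"

text \<open>The law of \<open>t\<close> independent copies, indexed by \<open>{1..t}\<close>.\<close>

definition Hz_copies_pmf ::
    "nat \<Rightarrow> nat \<Rightarrow> nat \<Rightarrow> (nat \<Rightarrow> (nat \<Rightarrow> int) \<times> (nat \<Rightarrow> int)) pmf" where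
  "Hz_copies_pmf d N t = Pi_pmf {1..t} undefined (\<lambda>_. Hz_pmf d N)"

text \<open>For lists of odd length the two entries that are averaged coincide.\<close>

definition median :: "real list \<Rightarrow> real" where
  "median xs = (sort xs ! ((length xs - 1) div 2) + sort xs ! (length xs div 2)) / 2"

definition cmedian :: "complex list \<Rightarrow> complex" where
  "cmedian ys = Complex (median (map Re ys)) (median (map Im ys))"

definition median_quad ::
    "nat \<Rightarrow> ((nat \<Rightarrow> real) \<Rightarrow> complex) \<Rightarrow> nat \<Rightarrow> int \<Rightarrow> real \<Rightarrow> nat \<Rightarrow>
     (nat \<Rightarrow> (nat \<Rightarrow> int) \<times> (nat \<Rightarrow> int)) \<Rightarrow> complex" where
  "median_quad d f N L r t \<omega> = cmedian (map (\<lambda>j. quad d f N L r (\<omega> j)) [1..<Suc t])"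

end

theory Submission
  imports Defs
begin

text \<open>
  With \<open>f\<close> expanded in its Fourier series, the error of the quadrature is the sum over the
  frequencies \<open>k \<noteq> 0\<close> of \<open>c(k) S(k\<cdot>H/N)\<close> times a unimodular factor, where \<open>c(k)\<close> is the Fourier coefficient and \<open>S\<close> is the exponential sum of
  the Gaussian weights, plus \<open>INT(f)\<close> times \<open>S(0) - 1\<close>. Frequencies whose nonzero entries are all at
  least \<open>N\<close> in absolute value carry at most \<open>\<epsilon>\<close> of the norm. For the others
  \<open>k\<cdot>H\<close> is nearly equidistributed modulo the prime \<open>N\<close>, and the average of \<open>|S|\<close> over the multiples of
  \<open>1/N\<close> is \<open>O(1/r)\<close>. So the error is at most \<open>O(1/r + \<epsilon>)\<close> plus a nonnegative random
  variable \<open>X\<close> of expectation at most \<open>10/r\<close>; since the bound claimed is of size \<open>1/(r\<sigma>) + \<epsilon>\<close>, Markov's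
  inequality suffices and no Poisson summation is needed. For the median, at least \<open>s = (t+1)/2\<close> of
  the copies have an error comparable to that of the median, so the \<open>s\<close>-th power of the excess is
  bounded by the sum over \<open>s\<close>-element sets of copies of the products of their \<open>X\<close>, whose expectation is
  at most \<open>2\<^sup>t (10/r)\<^sup>s\<close>.
\<close>

section \<open>Fourier inversion on the torus\<close>

text \<open>The nodes form a null set, so Fourier inversion has to hold at every point; tensor
  products of Fejer kernels give this for continuous \<open>f\<close> with absolutely summable
  coefficients. For the average of \<open>|S|\<close>, Parseval with Cauchy-Schwarz alone would give
  only the order \<open>r^(-1/2)\<close>; the missing factor comes from the decay of
  \<open>S\<close> away from the integers, which summation by parts provides. The obstacle there is
  the sharp cutoff at \<open>L\<close>: it produces two jumps of height
  \<open>gauss_weight r L\<close>. They stay small because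
  \<open>q = exp (- L^2 / (2 * r^2))\<close> satisfies \<open>q^2 \<le> 5 / r\<close>, which is
  extracted from the choice of \<open>L\<close> and \<open>B\<close> and from \<epsilon> < \<sigma>
  / n. The constant is absolute because the dimension enters only through error terms that vanish in
  the limit of the Fejer means and through the number of vectors \<open>H\<close>, where it cancels.
  The rate \<open>1 / r\<close> turns into \<open>ln (1 / \<epsilon>) / L\<close> because
  \<open>L \<le> 3 * ln (1 / \<epsilon>) * r\<close>.\<close>

definition fejer :: "nat \<Rightarrow> real \<Rightarrow> real" where
  "fejer M u = (cmod (\<Sum>a\<le>M. cis (2 * pi * (real a * u))))\<^sup>2 / (real M + 1)"

lemma fejer_nonneg: "0 \<le> fejer M u"
  by (simp add: fejer_def)

text \<open>The difference \<open>k\<close> is attained by \<open>M + 1 - |k|\<close> pairs. Passing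
  from \<open>M\<close> to \<open>M + 1\<close> adds one row and one column, in which every
  difference from \<open>-(M + 1)\<close> to \<open>M + 1\<close> occurs exactly once.\<close>

lemma sum_differences:
  fixes h :: "int \<Rightarrow> complex"
  shows "(\<Sum>a\<le>M. \<Sum>b\<le>M. h (int a - int b)) =
         (\<Sum>k\<in>{-int M..int M}. of_int (int M + 1 - \<bar>k\<bar>) * h k)"
proof (induction M)
  case 0
  show ?case by simp
next
  case (Suc M)
  have ends: "{-int (Suc M)..int (Suc M)} = insert (-int (Suc M)) (insert (int (Suc M)) {-int M..int M})"
    by auto
  have 1: "(\<Sum>a\<le>M. h (int a - int (Suc M))) = (\<Sum>k\<in>{-int (Suc M)..-1}. h k)"
    by (rule sum.reindex_bij_witness[where i = "\<lambda>k. nat (k + int (Suc M))" and j = "\<lambda>a. int a - int (Suc M)"]) auto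
  have 2: "(\<Sum>b\<le>Suc M. h (int (Suc M) - int b)) = (\<Sum>k\<in>{0..int (Suc M)}. h k)"
    by (rule sum.reindex_bij_witness[where i = "\<lambda>k. nat (int (Suc M) - k)" and j = "\<lambda>b. int (Suc M) - int b"]) auto
  have 3: "{-int (Suc M)..int (Suc M)} = {-int (Suc M)..-1} \<union> {0..int (Suc M)}"
    by auto
  have all: "(\<Sum>k\<in>{-int (Suc M)..int (Suc M)}. h k) =
      (\<Sum>k\<in>{-int (Suc M)..-1}. h k) + (\<Sum>k\<in>{0..int (Suc M)}. h k)"
    unfolding 3 by (rule sum.union_disjoint) auto
  have "(\<Sum>a\<le>Suc M. \<Sum>b\<le>Suc M. h (int a - int b)) =
      (\<Sum>a\<le>M. \<Sum>b\<le>M. h (int a - int b)) + (\<Sum>a\<le>M. h (int a - int (Suc M)))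
      + (\<Sum>b\<le>Suc M. h (int (Suc M) - int b))"
    by (simp add: sum.distrib)
  also have "\<dots> = (\<Sum>k\<in>{-int M..int M}. of_int (int M + 1 - \<bar>k\<bar>) * h k) + (\<Sum>k\<in>{-int (Suc M)..int (Suc M)}. h k)"
    unfolding Suc.IH all 1 2 by simp
  \<comment> \<open>The two new endpoints may be included because the coefficient
    \<open>M + 1 - |k|\<close> vanishes there.\<close>
  also have "(\<Sum>k\<in>{-int M..int M}. of_int (int M + 1 - \<bar>k\<bar>) * h k) =
      (\<Sum>k\<in>{-int (Suc M)..int (Suc M)}. of_int (int M + 1 - \<bar>k\<bar>) * h k)"
    unfolding ends by (subst sum.insert; simp)+
  also have "\<dots> + (\<Sum>k\<in>{-int (Suc M)..int (Suc M)}. h k) =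
     (\<Sum>k\<in>{-int (Suc M)..int (Suc M)}. of_int (int (Suc M) + 1 - \<bar>k\<bar>) * h k)"
    unfolding sum.distrib[symmetric] by (rule sum.cong) (auto simp: algebra_simps)
  finally show ?case .
qed

lemma fejer_expansion:
  "complex_of_real (fejer M u) =
     (\<Sum>k\<in>{-int M..int M}. of_real (1 - real_of_int \<bar>k\<bar> / (real M + 1)) * cis (2 * pi * (real_of_int k * u)))"
proof -
  let ?h = "\<lambda>k::int. cis (2 * pi * (real_of_int k * u))"
  let ?z = "\<Sum>a\<le>M. cis (2 * pi * (real a * u))"
  have "complex_of_real ((cmod ?z)\<^sup>2) = ?z * cnj ?z"
    by (rule complex_norm_square)
  also have "\<dots> = (\<Sum>a\<le>M. \<Sum>b\<le>M. ?h (int a - int b))"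
    by (simp add: sum_product cis_cnj cis_mult algebra_simps)
  also have "\<dots> = (\<Sum>k\<in>{-int M..int M}. of_int (int M + 1 - \<bar>k\<bar>) * ?h k)"
    by (rule sum_differences)
  finally have "complex_of_real (fejer M u) = (\<Sum>k\<in>{-int M..int M}. of_int (int M + 1 - \<bar>k\<bar>) * ?h k) / (of_nat M + 1)"
    by (simp add: fejer_def)
  also have "\<dots> = (\<Sum>k\<in>{-int M..int M}. of_real (1 - real_of_int \<bar>k\<bar> / (real M + 1)) * ?h k)"
    unfolding sum_divide_distrib
    by (rule sum.cong) (auto simp: field_simps simp del: of_nat_Suc
      simp flip: of_nat_Suc of_int_abs)
  finally show ?thesis .
qed

lemma cmod_one_minus_cis: "(cmod (1 - cis (2 * pi * u)))\<^sup>2 = 4 * (sin (pi * u))\<^sup>2"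
proof -
  have "(cmod (1 - cis (2 * pi * u)))\<^sup>2 = (1 - cos (2 * pi * u))\<^sup>2 + (sin (2 * pi * u))\<^sup>2"
    by (simp add: cmod_def)
  also have "\<dots> = 2 - 2 * cos (2 * (pi * u))"
    using sin_cos_squared_add[of "2*pi*u"] by (simp add: power2_eq_square algebra_simps)
  also have "\<dots> = 4 * (sin (pi * u))\<^sup>2"
    unfolding cos_double_sin by simp
  finally show ?thesis .
qed

text \<open>Multiplying the geometric sum by \<open>|1 - z|\<close> leaves
  \<open>|1 - z^(M+1)| \<le> 2\<close>, and \<open>|1 - z|^2\<close> is four times the squared sine.
  This expresses the concentration of the kernel at the integers without splitting the domain into
  near and far points.\<close>

lemma fejer_sin_le: "fejer M u * (sin (pi * u))\<^sup>2 \<le> 1 / (real M + 1)"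
proof -
  let ?z = "cis (2 * pi * u)"
  have pw: "(\<Sum>a\<le>M. cis (2 * pi * (real a * u))) = (\<Sum>a\<le>M. ?z ^ a)"
    by (rule sum.cong) (simp_all add: Complex.DeMoivre mult_ac)
  have n1: "(cmod (1 - ?z))\<^sup>2 = 4 * (sin (pi * u))\<^sup>2"
    by (rule cmod_one_minus_cis)
  have "cmod (1 - ?z) * cmod (\<Sum>a\<le>M. ?z ^ a) = cmod (1 - ?z ^ Suc M)"
    unfolding norm_mult[symmetric] by (simp only: sum_gp_basic)
  also have "\<dots> \<le> 2"
    using norm_triangle_ineq4[of 1 "?z ^ Suc M"] by (simp add: norm_power norm_mult)
  finally have "(cmod (1 - ?z) * cmod (\<Sum>a\<le>M. ?z ^ a))\<^sup>2 \<le> 2\<^sup>2"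
    by (rule power_mono) simp
  then have "4 * ((sin (pi * u))\<^sup>2 * (cmod (\<Sum>a\<le>M. ?z ^ a))\<^sup>2) \<le> 4"
    by (simp add: power_mult_distrib n1)
  then show ?thesis
    unfolding fejer_def pw by (simp add: divide_right_mono mult.commute)
qed

text \<open>The sums are read as integrals over counting measure, where dominated convergence
  applies with majorant \<open>|c|\<close>. It serves to pass to the limit in the Fejer
  means.\<close>

lemma infsum_dominated_convergence:
  fixes c :: "'a \<Rightarrow> complex" and \<rho> :: "nat \<Rightarrow> 'a \<Rightarrow> real"
  assumes c: "(\<lambda>k. cmod (c k)) summable_on A"
    and \<rho>: "\<And>M k. k \<in> A \<Longrightarrow> \<bar>\<rho> M k\<bar> \<le> 1"
    and lim: "\<And>k. k \<in> A \<Longrightarrow> (\<lambda>M. \<rho> M k) \<longlonglongrightarrow> 1"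
  shows "(\<lambda>M. \<Sum>\<^sub>\<infinity>k\<in>A. of_real (\<rho> M k) * c k) \<longlonglongrightarrow> (\<Sum>\<^sub>\<infinity>k\<in>A. c k)"
proof -
  have cA: "Infinite_Set_Sum.abs_summable_on c A"
    using c by (simp add: abs_summable_equivalent)
  have sA: "Infinite_Set_Sum.abs_summable_on (\<lambda>k. of_real (\<rho> M k) * c k) A" for M
    by (rule abs_summable_on_comparison_test[OF cA]) (use \<rho> in \<open>auto simp: norm_mult intro!: mult_left_le_one_le\<close>)
  have "(\<lambda>M. infsetsum (\<lambda>k. of_real (\<rho> M k) * c k) A) \<longlonglongrightarrow> infsetsum c A"
    unfolding infsetsum_def
  proof (rule integral_dominated_convergence[where w = "\<lambda>k. cmod (c k)"])
    show "integrable (count_space A) (\<lambda>k. cmod (c k))"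
      using c by (metis abs_summable_equivalent abs_summable_on_def integrable_norm cA)
    show "AE x in count_space A. (\<lambda>i. complex_of_real (\<rho> i x) * c x) \<longlonglongrightarrow> c x"
      using lim by (auto simp: AE_count_space intro!: tendsto_eq_intros)
    show "AE x in count_space A. cmod (complex_of_real (\<rho> i x) * c x) \<le> cmod (c x)" for i
      using \<rho> by (auto simp: AE_count_space norm_mult intro!: mult_left_le_one_le)
  qed auto
  then show ?thesis
    using cA sA by (simp add: infsetsum_infsum abs_summable_equivalent)
qed

section \<open>Characters and integration over the unit cube\<close>

definition chr :: "nat \<Rightarrow> (nat \<Rightarrow> int) \<Rightarrow> (nat \<Rightarrow> real) \<Rightarrow> complex" where
  "chr d k x = cis (2 * pi * (\<Sum>j<d. real_of_int (k j) * x j))"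

lemma norm_chr [simp]: "cmod (chr d k x) = 1"
  by (simp add: chr_def)

lemma fourier_coeff_chr:
  "fourier_coeff d f k = (LINT x:unit_cube d|lebesgue_vec d. f x * cnj (chr d k x))"
proof -
  have "exp (- (2 * complex_of_real pi * \<i> * complex_of_real s)) = cnj (cis (2 * pi * s))" for s
    by (simp add: cis_cnj) (simp add: cis_conv_exp mult_ac)
  then show ?thesis
    by (simp only: fourier_coeff_def chr_def)
qed

interpretation lborel_prod: product_sigma_finite "\<lambda>_::nat. lborel :: real measure"
  by standard

lemma space_lebesgue_vec: "space (lebesgue_vec d) = RVec d"
  by (simp add: space_PiM RVec_def)

lemma unit_cube_sets [measurable]: "unit_cube d \<in> sets (lebesgue_vec d)"
  unfolding unit_cube_def by (rule sets_PiM_I_finite) auto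

lemma emeasure_unit_cube: "emeasure (lebesgue_vec d) (unit_cube d) = 1"
  unfolding unit_cube_def by (subst lborel_prod.emeasure_PiM) auto

lemma unit_cube_subset: "unit_cube d \<subseteq> RVec d"
  by (auto simp: unit_cube_def RVec_def PiE_def)

text \<open>Fubini for products: on extensional functions the indicator of the cube is the product
  of the indicators of its sides.\<close>

lemma set_integral_unit_cube_prod:
  fixes g :: "nat \<Rightarrow> real \<Rightarrow> real"
  assumes "\<And>j. j < d \<Longrightarrow> set_integrable lborel {0..1} (g j)"
  shows "(LINT x:unit_cube d|lebesgue_vec d. \<Prod>j<d. g j (x j)) =
         (\<Prod>j<d. LINT u:{0..1}|lborel. g j u)"
proof -
  have "(LINT x:unit_cube d|lebesgue_vec d. \<Prod>j<d. g j (x j)) =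
     (\<integral>x. (\<Prod>j<d. indicator {0..1} (x j) * g j (x j)) \<partial>lebesgue_vec d)"
    unfolding set_lebesgue_integral_def
  proof (rule Bochner_Integration.integral_cong[OF refl])
    fix x assume "x \<in> space (lebesgue_vec d)"
    then have "indicator (unit_cube d) x = (\<Prod>j<d. indicator {0..1} (x j) :: real)"
      by (auto simp: space_lebesgue_vec RVec_def unit_cube_def indicator_def PiE_def Pi_iff)
    then show "indicator (unit_cube d) x *\<^sub>R (\<Prod>j<d. g j (x j)) = (\<Prod>j<d. indicator {0..1} (x j) * g j (x j))"
      by (simp add: prod.distrib)
  qed
  also have "\<dots> = (\<Prod>j<d. \<integral>u. indicator {0..1} u * g j u \<partial>lborel)"
    using assms by (intro lborel_prod.product_integral_prod) (auto simp: set_integrable_def)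
  finally show ?thesis
    by (simp add: set_lebesgue_integral_def)
qed

lemma set_integrable_unit_cube:
  fixes g :: "(nat \<Rightarrow> real) \<Rightarrow> 'b::{banach, second_countable_topology}"
  assumes "g \<in> borel_measurable (lebesgue_vec d)" "\<And>x. x \<in> unit_cube d \<Longrightarrow> norm (g x) \<le> B"
  shows "set_integrable (lebesgue_vec d) (unit_cube d) g"
  unfolding set_integrable_def
  by (rule integrableI_bounded_set_indicator[where B = B])
     (use assms in \<open>auto simp: emeasure_unit_cube\<close>)

section \<open>Continuous functions on the torus\<close>

lemma torus_compose_continuous:
  assumes "continuous_torus d f"
  shows "continuous_on UNIV (\<lambda>y::nat\<Rightarrow>real. f (restrict y {..<d}))"
proof -
  have "continuous_map euclidean (product_topology (\<lambda>_. euclideanreal) {..<d}) (\<lambda>y::nat\<Rightarrow>real. restrict y {..<d})"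
    unfolding continuous_map_componentwise
    by (auto simp: continuous_on_product_coordinates cong: restrict_cong)
  then have "continuous_map euclidean euclidean (f \<circ> (\<lambda>y::nat\<Rightarrow>real. restrict y {..<d}))"
    using assms unfolding continuous_torus_def by (blast intro: continuous_map_compose)
  then show ?thesis
    by (simp add: o_def)
qed

text \<open>Continuity refers to the topology on extensional functions, measurability to the product
  sigma-algebra. The detour fills the coordinates outside \<open>{..<d}\<close> with 0 and so
  reaches \<open>nat \<Rightarrow> real\<close>, where a map is Borel measurable as soon as its
  coordinates are.\<close>

lemma torus_measurable:
  assumes "continuous_torus d f"
  shows "f \<in> borel_measurable (lebesgue_vec d)"
proof -
  let ?e = "\<lambda>x j. if j \<in> {..<d} then x j else (0::real)"
  have "(\<lambda>y::nat\<Rightarrow>real. f (restrict y {..<d})) \<in> borel_measurable borel"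
    using torus_compose_continuous[OF assms] by (rule borel_measurable_continuous_onI)
  moreover have "?e \<in> measurable (lebesgue_vec d) borel"
    by (rule measurable_coordinatewise_then_product, rename_tac i, case_tac "i < d") auto
  ultimately have "(\<lambda>x. f (restrict (?e x) {..<d})) \<in> borel_measurable (lebesgue_vec d)"
    by (rule measurable_compose[rotated])
  moreover have "f (restrict (?e x) {..<d}) = f x" if "x \<in> space (lebesgue_vec d)" for x
    using that by (intro arg_cong[where f = f]) (auto simp: space_lebesgue_vec RVec_def PiE_def extensional_def)
  ultimately show ?thesis
    by (simp cong: measurable_cong)
qed

lemma compactin_unit_cube:
  "compactin (product_topology (\<lambda>_. euclideanreal) {..<d}) (unit_cube d)"
  unfolding unit_cube_def by (auto simp: compactin_PiE)

lemma torus_bounded: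
  assumes "continuous_torus d f"
  obtains K where "0 < K" "\<And>x. x \<in> unit_cube d \<Longrightarrow> cmod (f x) \<le> K"
proof -
  have "compactin euclidean (f ` unit_cube d)"
    by (rule image_compactin[OF compactin_unit_cube])
      (use assms in \<open>auto simp: continuous_torus_def\<close>)
  then have "bounded (f ` unit_cube d)"
    by (simp add: compact_imp_bounded)
  then show ?thesis
    using that by (auto simp: bounded_pos)
qed

lemma torus_shift_nat:
  assumes "continuous_torus d f" "x \<in> RVec d" "j < d"
  shows "f (x(j := x j + real n)) = f x"
proof (induction n)
  case (Suc n)
  let ?y = "x(j := x j + real n)"
  have "?y \<in> RVec d"
    using assms(2,3) by (auto simp: RVec_def PiE_def extensional_def)
  then have "f (?y(j := ?y j + 1)) = f ?y"
    using assms(1,3) unfolding continuous_torus_def by blast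
  moreover have "?y(j := ?y j + 1) = x(j := x j + real (Suc n))"
    by auto
  ultimately show ?case
    using Suc by metis
qed simp

lemma torus_shift_int:
  assumes "continuous_torus d f" "x \<in> RVec d" "j < d"
  shows "f (x(j := x j + real_of_int n)) = f x"
proof (cases "n \<ge> 0")
  case True
  then show ?thesis
    using torus_shift_nat[OF assms, of "nat n"] by simp
next
  case False
  let ?y = "x(j := x j + real_of_int n)"
  have "?y \<in> RVec d"
    using assms(2,3) by (auto simp: RVec_def PiE_def extensional_def)
  then show ?thesis
    using torus_shift_nat[OF assms(1) _ assms(3), of ?y "nat (-n)"] False by simp
qed

text \<open>The path from \<open>y\<close> to \<open>x\<close> runs through hybrid points that agree
  with \<open>x\<close> below \<open>m\<close> and with \<open>y\<close> from \<open>m\<close> on,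
  so each step is an integer shift of a single coordinate.\<close>

lemma torus_periodic:
  assumes f: "continuous_torus d f" and x: "x \<in> RVec d" and y: "y \<in> RVec d"
    and diff: "\<And>j. j < d \<Longrightarrow> x j - y j \<in> \<int>"
  shows "f x = f y"
proof -
  have "f (\<lambda>j. if j < m then x j else y j) = f y" if "m \<le> d" for m
    using that
  proof (induction m)
    case (Suc m)
    let ?w = "\<lambda>j. if j < m then x j else y j"
    obtain n where n: "x m - y m = real_of_int n"
      using diff[of m] Suc.prems by (auto elim: Ints_cases)
    have "?w \<in> RVec d"
      using x y Suc.prems by (auto simp: RVec_def PiE_def extensional_def)
    then have "f (?w(m := ?w m + real_of_int n)) = f ?w"
      using torus_shift_int[OF f _ Suc_le_lessD[OF Suc.prems]] by blast
    moreover have "?w(m := ?w m + real_of_int n) = (\<lambda>j. if j < Suc m then x j else y j)"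
      using n by (auto simp: less_Suc_eq)
    ultimately show ?case
      using Suc by simp
  qed simp
  then have "f (\<lambda>j. if j < d then x j else y j) = f y" by simp
  moreover have "(\<lambda>j. if j < d then x j else y j) = x"
    using x y by (auto simp: RVec_def PiE_def extensional_def)
  ultimately show ?thesis by simp
qed

text \<open>The modulus of continuity is measured in the weight that the Fejer kernel tames, see \<open>fejer_sin_le\<close>.\<close>

lemma torus_modulus:
  assumes f: "continuous_torus d f" and x0: "x0 \<in> unit_cube d" and \<eta>: "0 < \<eta>"
  obtains K where "0 \<le> K"
    "\<And>x. x \<in> unit_cube d \<Longrightarrow> cmod (f x - f x0) \<le> \<eta> + K * (\<Sum>j<d. (sin (pi * (x0 j - x j)))\<^sup>2)"
proof -
  define X where "X = product_topology (\<lambda>_. euclideanreal) {..<d}"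
  define h where "h = (\<lambda>x. \<Sum>j<d. (sin (pi * (x0 j - x j)))\<^sup>2)"
  \<comment> \<open>The compact part of the cube where \<open>f\<close> is off by at least \<eta>.
    There \<open>h\<close> vanishes nowhere: \<open>h x = 0\<close> would make all coordinate
    differences integers, hence \<open>f x = f x0\<close> by periodicity. A positive lower bound
    \<open>c\<close> of \<open>h\<close> on \<open>S\<close> turns the trivial bound
    \<open>2 * B\<close> into \<open>2 * B / c * h x\<close>.\<close>
  define S where "S = unit_cube d \<inter> {x \<in> topspace X. cmod (f x - f x0) \<in> {\<eta>..}}"
  have h0: "0 \<le> h x" for x
    unfolding h_def by (intro sum_nonneg) auto
  have proj: "continuous_map X euclideanreal (\<lambda>x. x j)" if "j < d" for j
    unfolding X_def using that by (auto intro: continuous_map_product_projection)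
  have sinc: "continuous_map euclideanreal euclideanreal (\<lambda>t. (sin (pi * (x0 j - t)))\<^sup>2)" for j
    by (auto intro!: continuous_intros)
  have "continuous_map X euclideanreal (\<lambda>x. (sin (pi * (x0 j - x j)))\<^sup>2)" if "j < d" for j
    using continuous_map_compose[OF proj[OF that] sinc] by (simp add: o_def)
  then have hc: "continuous_map X euclideanreal h"
    unfolding h_def by (intro continuous_map_sum) auto
  have fc: "continuous_map X euclidean f"
    using f by (simp add: continuous_torus_def X_def)
  have nc: "continuous_map euclidean euclideanreal (\<lambda>w::complex. cmod (w - f x0))"
    by (auto intro!: continuous_intros)
  have fc': "continuous_map X euclideanreal (\<lambda>x. cmod (f x - f x0))"
    using continuous_map_compose[OF fc nc] by (simp add: o_def)
  have "closedin X {x \<in> topspace X. cmod (f x - f x0) \<in> {\<eta>..}}"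
    by (rule closedin_continuous_map_preimage[OF fc']) simp
  then have Sc: "compactin X S"
    unfolding S_def using compactin_unit_cube[of d]
    by (metis X_def compact_Int_closedin)
  then have "compactin euclideanreal (h ` S)"
    by (rule image_compactin[OF _ hc])
  then have hS: "compact (h ` S)"
    by simp
  have pos: "0 < h x" if "x \<in> S" for x
  proof (rule ccontr)
    assume "\<not> 0 < h x"
    then have "h x = 0" using h0[of x] by simp
    then have "\<forall>j\<in>{..<d}. (sin (pi * (x0 j - x j)))\<^sup>2 = 0"
      unfolding h_def by (subst (asm) sum_nonneg_eq_0_iff) auto
    then have "x0 j - x j \<in> \<int>" if "j < d" for j
      using that by (auto simp: sin_zero_iff_int2) (metis Ints_of_int lessThan_iff)
    moreover have "x \<in> RVec d" "x0 \<in> RVec d"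
      using that x0 unit_cube_subset by (auto simp: S_def)
    ultimately have "f x0 = f x"
      by (intro torus_periodic[OF f])
    then show False using that \<eta> by (auto simp: S_def)
  qed
  obtain c where c: "0 < c" "\<And>x. x \<in> S \<Longrightarrow> c \<le> h x"
  proof (cases "S = {}")
    case True
    then show ?thesis using that[of 1] by auto
  next
    case False
    then obtain y where "y \<in> S" "\<forall>x\<in>S. h y \<le> h x"
      using compact_attains_inf[OF hS] by auto
    then show ?thesis using that[of "h y"] pos by auto
  qed
  obtain B where B: "0 < B" "\<And>x. x \<in> unit_cube d \<Longrightarrow> cmod (f x) \<le> B"
    using torus_bounded[OF f] by blast
  have "cmod (f x - f x0) \<le> \<eta> + (2 * B / c) * h x" if x: "x \<in> unit_cube d" for x
  proof (cases "x \<in> S")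
    case True
    have "cmod (f x - f x0) \<le> 2 * B"
      using norm_triangle_ineq4[of "f x" "f x0"] B(2)[OF x] B(2)[OF x0] by linarith
    also have "\<dots> \<le> (2 * B / c) * h x"
      using B(1) c(1) c(2)[OF True] by (simp add: field_simps)
    finally show ?thesis using \<eta> by simp
  next
    case False
    have "x \<in> topspace X"
      using x by (auto simp: X_def unit_cube_def PiE_def)
    then have "cmod (f x - f x0) < \<eta>"
      using False x by (auto simp: S_def)
    moreover have "0 \<le> (2 * B / c) * h x"
      using B(1) c(1) h0 by simp
    ultimately show ?thesis by linarith
  qed
  then show ?thesis
    using that[of "2 * B / c"] B(1) c(1) by (simp add: h_def)
qed

section \<open>Fejer kernels as an approximate identity\<close>

lemma interval_cis_integral:
  assumes "k \<noteq> 0"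
  shows "(CLINT u:{0..1}|lborel. cis (2 * pi * (real_of_int k * (c - u)))) = 0"
proof -
  define a where "a = 2 * pi * real_of_int k"
  let ?G = "\<lambda>z::complex. exp (\<i> * of_real a * (of_real c - z)) / (- \<i> * of_real a)"
  have a0: "a \<noteq> 0" using assms by (simp add: a_def)
  have e: "exp (\<i> * of_real a * (of_real c - of_real u)) = cis (2 * pi * (real_of_int k * (c - u)))" for u :: real
    by (simp add: cis_conv_exp a_def mult_ac)
  have "((\<lambda>u. ?G (of_real u)) has_vector_derivative exp (\<i> * of_real a * (of_real c - of_real u))) (at u within {0..1})" for u
    by (rule has_vector_derivative_real_field)
       (use a0 in \<open>auto intro!: derivative_eq_intros simp: field_simps\<close>)
  then have "((\<lambda>u. exp (\<i> * of_real a * (of_real c - of_real u))) has_integral (?G (of_real 1) - ?G (of_real 0))) {0..1}"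
    by (intro fundamental_theorem_of_calculus) auto
  moreover have "?G (of_real 1) = ?G (of_real 0)"
  proof -
    have "cis (2 * pi * (real_of_int k * (c - 1))) = cis (2 * pi * (real_of_int k * (c - 0))) * cis (2 * pi * real_of_int (-k))"
      by (simp add: cis_mult algebra_simps)
    also have "cis (2 * pi * real_of_int (-k)) = 1"
      by (rule cis_multiple_2pi) simp
    finally show ?thesis unfolding e by simp
  qed
  ultimately have "((\<lambda>u. cis (2 * pi * (real_of_int k * (c - u)))) has_integral 0) {0..1}"
    unfolding e by (metis cancel_comm_monoid_add_class.diff_cancel)
  moreover have "set_integrable lborel {0..1} (\<lambda>u. cis (2 * pi * (real_of_int k * (c - u))))"
    by (intro borel_integrable_atLeastAtMost') (auto intro!: continuous_intros)
  ultimately show ?thesis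
    by (simp add: set_borel_integral_eq_integral(2) integral_unique)
qed

lemma fejer_continuous: "continuous_on A (\<lambda>u. fejer M (g u))" if "continuous_on A g"
  unfolding fejer_def by (intro continuous_intros that) auto

lemma fejer_integrable: "set_integrable lborel {0..1} (\<lambda>u. fejer M (c - u))"
  by (intro borel_integrable_atLeastAtMost' fejer_continuous continuous_intros)

text \<open>Integration leaves only the frequency 0 of the finite expansion, whose coefficient is
  1.\<close>

lemma fejer_integral: "(LINT u:{0..1}|lborel. fejer M (c - u)) = 1"
proof -
  let ?e = "\<lambda>k u. cis (2 * pi * (real_of_int k * (c - u)))"
  have int: "set_integrable lborel {0..1} (?e k)" for k
    by (intro borel_integrable_atLeastAtMost') (auto intro!: continuous_intros)
  have "complex_of_real (LINT u:{0..1}|lborel. fejer M (c - u)) =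
     (CLINT u:{0..1}|lborel. (\<Sum>k\<in>{-int M..int M}. of_real (1 - real_of_int \<bar>k\<bar> / (real M + 1)) * ?e k u))"
    unfolding fejer_expansion[symmetric] by (rule set_integral_complex_of_real[symmetric])
  also have "\<dots> = (\<Sum>k\<in>{-int M..int M}. (CLINT u:{0..1}|lborel. of_real (1 - real_of_int \<bar>k\<bar> / (real M + 1)) * ?e k u))"
    unfolding set_lebesgue_integral_def scaleR_sum_right
    using int by (intro Bochner_Integration.integral_sum)
      (simp add: set_integrable_def mult_scaleR_right[symmetric] del: mult_scaleR_right)
  also have "\<dots> = (\<Sum>k\<in>{-int M..int M}. if k = 0 then 1 else 0)"
  proof (rule sum.cong[OF refl])
    fix k :: int
    show "(CLINT u:{0..1}|lborel. of_real (1 - real_of_int \<bar>k\<bar> / (real M + 1)) * ?e k u) = (if k = 0 then 1 else 0)"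
    proof (cases "k = 0")
      case True
      then show ?thesis by (simp add: set_lebesgue_integral_def)
    next
      case False
      then show ?thesis
        using interval_cis_integral[OF False, of c] by simp
    qed
  qed
  also have "\<dots> = 1" by simp
  finally show ?thesis by (metis of_real_eq_1_iff)
qed

definition kernel :: "nat \<Rightarrow> nat \<Rightarrow> (nat \<Rightarrow> real) \<Rightarrow> (nat \<Rightarrow> real) \<Rightarrow> real" where
  "kernel d M x0 x = (\<Prod>j<d. fejer M (x0 j - x j))"

text \<open>A crude bound that serves integrability only; no quantitative estimate rests on
  it.\<close>

lemma fejer_le: "fejer M u \<le> real M + 1"
proof -
  have "cmod (\<Sum>a\<le>M. cis (2 * pi * (real a * u))) \<le> real M + 1"
    using norm_sum[of "\<lambda>a. cis (2 * pi * (real a * u))" "{..M}"] by simp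
  then have "(cmod (\<Sum>a\<le>M. cis (2 * pi * (real a * u))))\<^sup>2 \<le> (real M + 1)\<^sup>2"
    by (rule power_mono) simp
  then show ?thesis
    by (simp add: fejer_def divide_le_eq power2_eq_square)
qed

lemma kernel_nonneg: "0 \<le> kernel d M x0 x"
  unfolding kernel_def by (intro prod_nonneg) (auto simp: fejer_nonneg)

lemma kernel_le: "kernel d M x0 x \<le> (real M + 1) ^ d"
proof -
  have "kernel d M x0 x \<le> (\<Prod>j<d. real M + 1)"
    unfolding kernel_def by (intro prod_mono) (auto simp: fejer_nonneg fejer_le)
  then show ?thesis by simp
qed

lemma fejer_measurable [measurable]: "fejer M \<in> borel_measurable borel"
  using fejer_continuous[of UNIV "\<lambda>u. u" M] by (intro borel_measurable_continuous_onI) auto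

lemma kernel_measurable [measurable]: "kernel d M x0 \<in> borel_measurable (lebesgue_vec d)"
  unfolding kernel_def by measurable

lemma kernel_integrable: "set_integrable (lebesgue_vec d) (unit_cube d) (kernel d M x0)"
  by (rule set_integrable_unit_cube[where B = "(real M + 1) ^ d"])
     (auto simp: kernel_nonneg kernel_le)

lemma kernel_integral: "(LINT x:unit_cube d|lebesgue_vec d. kernel d M x0 x) = 1"
  unfolding kernel_def
  by (subst set_integral_unit_cube_prod[where g = "\<lambda>j u. fejer M (x0 j - u)"])
     (simp_all add: fejer_integrable fejer_integral)

lemma kernel_sin_integrable:
  "set_integrable (lebesgue_vec d) (unit_cube d) (\<lambda>x. (sin (pi * (x0 j - x j)))\<^sup>2 * kernel d M x0 x)"
  if "j < d"
proof (rule set_integrable_unit_cube[where B = "(real M + 1) ^ d"])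
  have [measurable]: "(\<lambda>x. x j) \<in> borel_measurable (lebesgue_vec d)"
    using measurable_component_singleton[of j "{..<d}" "\<lambda>_. lborel :: real measure"] that by simp
  show "(\<lambda>x. (sin (pi * (x0 j - x j)))\<^sup>2 * kernel d M x0 x) \<in> borel_measurable (lebesgue_vec d)"
    by measurable
  fix x
  have "(sin (pi * (x0 j - x j)))\<^sup>2 * kernel d M x0 x \<le> 1 * (real M + 1) ^ d"
    by (intro mult_mono kernel_le) (auto simp: kernel_nonneg abs_square_le_1)
  then show "norm ((sin (pi * (x0 j - x j)))\<^sup>2 * kernel d M x0 x) \<le> (real M + 1) ^ d"
    by (simp add: kernel_nonneg abs_mult)
qed

lemma kernel_sin_integral_le:
  assumes j: "j < d"
  shows "(LINT x:unit_cube d|lebesgue_vec d. (sin (pi * (x0 j - x j)))\<^sup>2 * kernel d M x0 x) \<le> 1 / (real M + 1)"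
proof -
  \<comment> \<open>The squared sine involves coordinate \<open>j\<close> alone. There
    \<open>fejer_sin_le\<close> replaces it together with its kernel factor by the constant
    \<open>1 / (M + 1)\<close>, while every other factor keeps integral 1.\<close>
  let ?g = "\<lambda>i u. if i = j then 1 / (real M + 1) else fejer M (x0 i - u)"
  have gi: "set_integrable lborel {0..1} (?g i)" for i
    using fejer_integrable[of M "x0 i"]
    by (cases "i = j") (auto simp: set_integrable_def intro!: integrable_real_mult_indicator)
  have le: "(sin (pi * (x0 j - x j)))\<^sup>2 * kernel d M x0 x \<le> (\<Prod>i<d. ?g i (x i))" for x
  proof -
    have "kernel d M x0 x = fejer M (x0 j - x j) * (\<Prod>i\<in>{..<d} - {j}. fejer M (x0 i - x i))"
      unfolding kernel_def using j by (subst prod.remove[of _ j]) auto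
    moreover have "(\<Prod>i<d. ?g i (x i)) = 1 / (real M + 1) * (\<Prod>i\<in>{..<d} - {j}. fejer M (x0 i - x i))"
      using j by (subst prod.remove[of _ j]) (auto intro!: prod.cong)
    moreover have "0 \<le> (\<Prod>i\<in>{..<d} - {j}. fejer M (x0 i - x i))"
      by (intro prod_nonneg) (auto simp: fejer_nonneg)
    ultimately show ?thesis
      using mult_right_mono[OF fejer_sin_le[of M "x0 j - x j"],
          of "\<Prod>i\<in>{..<d} - {j}. fejer M (x0 i - x i)"] by (simp add: mult_ac)
  qed
  have prod_int: "set_integrable (lebesgue_vec d) (unit_cube d) (\<lambda>x. \<Prod>i<d. ?g i (x i))"
  proof (rule set_integrable_unit_cube)
    show "(\<lambda>x. \<Prod>i<d. ?g i (x i)) \<in> borel_measurable (lebesgue_vec d)"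
      by measurable
    fix x
    have "1 / (real M + 1) \<le> real M + 1"
      by (rule order_trans[of _ 1]) auto
    then have "(\<Prod>i<d. ?g i (x i)) \<le> (\<Prod>i<d. real M + 1)"
      by (intro prod_mono) (auto simp: fejer_nonneg fejer_le)
    moreover have "0 \<le> (\<Prod>i<d. ?g i (x i))"
      by (intro prod_nonneg) (auto simp: fejer_nonneg)
    ultimately show "norm (\<Prod>i<d. ?g i (x i)) \<le> (real M + 1) ^ d"
      by simp
  qed
  have "(LINT x:unit_cube d|lebesgue_vec d. (sin (pi * (x0 j - x j)))\<^sup>2 * kernel d M x0 x)
      \<le> (LINT x:unit_cube d|lebesgue_vec d. (\<Prod>i<d. ?g i (x i)))"
    by (rule set_integral_mono[OF kernel_sin_integrable[OF j] prod_int le])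
  also have "\<dots> = (\<Prod>i<d. LINT u:{0..1}|lborel. ?g i u)"
    by (rule set_integral_unit_cube_prod[OF gi])
  also have "\<dots> = (\<Prod>i<d. if i = j then 1 / (real M + 1) else 1)"
    by (intro prod.cong refl) (use fejer_integral[of M] in \<open>simp add: set_lebesgue_integral_def\<close>)
  also have "\<dots> = 1 / (real M + 1)"
    using j by (simp add: prod.delta)
  finally show ?thesis .
qed

text \<open>The bound of \<open>torus_modulus\<close> is integrated against the kernel: its constant
  part keeps its size because the kernel is nonnegative with integral 1, and its sine part
  contributes at most \<open>K * d / (M + 1)\<close>. The size of \<open>K\<close> and
  \<open>d\<close> is harmless, since only the limit in \<open>M\<close> is taken.\<close>

lemma kernel_approximation:
  assumes f: "continuous_torus d f" and x0: "x0 \<in> unit_cube d"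
  shows "(\<lambda>M. CLINT x:unit_cube d|lebesgue_vec d. f x * of_real (kernel d M x0 x)) \<longlonglongrightarrow> f x0"
proof (rule LIMSEQ_I)
  fix e :: real assume e: "0 < e"
  obtain K where K: "0 \<le> K"
    "\<And>x. x \<in> unit_cube d \<Longrightarrow> cmod (f x - f x0) \<le> e / 2 + K * (\<Sum>j<d. (sin (pi * (x0 j - x j)))\<^sup>2)"
    using torus_modulus[OF f x0, of "e / 2"] e by auto
  obtain B where B: "0 < B" "\<And>x. x \<in> unit_cube d \<Longrightarrow> cmod (f x) \<le> B"
    using torus_bounded[OF f] by blast
  have [measurable]: "f \<in> borel_measurable (lebesgue_vec d)"
    using torus_measurable[OF f] .
  have bound: "cmod ((CLINT x:unit_cube d|lebesgue_vec d. f x * of_real (kernel d M x0 x)) - f x0)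
      \<le> e / 2 + K * d / (real M + 1)" for M
  proof -
    let ?k = "kernel d M x0"
    let ?s = "\<lambda>j x. (sin (pi * (x0 j - x j)))\<^sup>2"
    have i1: "set_integrable (lebesgue_vec d) (unit_cube d) (\<lambda>x. f x * of_real (?k x))"
    proof (rule set_integrable_unit_cube)
      show "norm (f x * of_real (?k x)) \<le> B * (real M + 1) ^ d" if "x \<in> unit_cube d" for x
        using B(1) B(2)[OF that] kernel_le[of d M x0 x] kernel_nonneg[of d M x0 x]
        by (auto simp: norm_mult intro!: mult_mono)
    qed measurable
    have i2: "set_integrable (lebesgue_vec d) (unit_cube d) (\<lambda>x. f x0 * of_real (?k x))"
    proof (rule set_integrable_unit_cube)
      show "norm (f x0 * of_real (?k x)) \<le> B * (real M + 1) ^ d" for x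
        using B(1) B(2)[OF x0] kernel_le[of d M x0 x] kernel_nonneg[of d M x0 x]
        by (auto simp: norm_mult intro!: mult_mono)
    qed measurable
    have i3: "set_integrable (lebesgue_vec d) (unit_cube d) (\<lambda>x. e / 2 * ?k x + (\<Sum>j<d. K * (?s j x * ?k x)))"
      unfolding set_integrable_def scaleR_add_right scaleR_sum_right
      using kernel_sin_integrable[of _ d x0 M] kernel_integrable[of d M x0]
      by (intro Bochner_Integration.integrable_add Bochner_Integration.integrable_sum)
         (auto simp: set_integrable_def mult.left_commute)
    have "(CLINT x:unit_cube d|lebesgue_vec d. f x0 * of_real (?k x)) = f x0"
      by (simp add: set_integral_complex_of_real kernel_integral)
    then have "(CLINT x:unit_cube d|lebesgue_vec d. f x * of_real (?k x)) - f x0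
       = (CLINT x:unit_cube d|lebesgue_vec d. f x * of_real (?k x) - f x0 * of_real (?k x))"
      using set_integral_diff(2)[OF i1 i2] by simp
    also have "cmod \<dots> \<le> (LINT x:unit_cube d|lebesgue_vec d. cmod (f x * of_real (?k x) - f x0 * of_real (?k x)))"
      by (rule set_integral_norm_bound[OF set_integral_diff(1)[OF i1 i2]])
    also have "\<dots> \<le> (LINT x:unit_cube d|lebesgue_vec d. e / 2 * ?k x + (\<Sum>j<d. K * (?s j x * ?k x)))"
    proof (rule set_integral_mono[OF set_integrable_norm[OF set_integral_diff(1)[OF i1 i2]] i3])
      fix x assume x: "x \<in> unit_cube d"
      have "cmod (f x * of_real (?k x) - f x0 * of_real (?k x)) = cmod (f x - f x0) * ?k x"
        by (metis abs_of_nonneg kernel_nonneg left_diff_distrib norm_mult norm_of_real)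
      also have "\<dots> \<le> (e / 2 + K * (\<Sum>j<d. ?s j x)) * ?k x"
        by (rule mult_right_mono[OF K(2)[OF x] kernel_nonneg])
      also have "\<dots> = e / 2 * ?k x + (\<Sum>j<d. K * (?s j x * ?k x))"
        by (simp add: algebra_simps sum_distrib_left sum_distrib_right)
      finally show "cmod (f x * of_real (?k x) - f x0 * of_real (?k x)) \<le> e / 2 * ?k x + (\<Sum>j<d. K * (?s j x * ?k x))" .
    qed
    also have "\<dots> = e / 2 * (LINT x:unit_cube d|lebesgue_vec d. ?k x)
        + (\<Sum>j<d. K * (LINT x:unit_cube d|lebesgue_vec d. ?s j x * ?k x))"
      using kernel_sin_integrable[of _ d x0 M] kernel_integrable[of d M x0]
      unfolding set_lebesgue_integral_def scaleR_add_right scaleR_sum_right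
      by (subst Bochner_Integration.integral_add)
         (auto simp: set_integrable_def mult.left_commute intro!: Bochner_Integration.integrable_sum)
    also have "\<dots> \<le> e / 2 * 1 + (\<Sum>j<d. K * (1 / (real M + 1)))"
      by (intro add_mono sum_mono mult_left_mono kernel_sin_integral_le) (use e in \<open>auto simp: kernel_integral K\<close>)
    finally show ?thesis by (simp add: mult_ac)
  qed
  obtain M0 :: nat where M0: "2 * K * d / e < real M0"
    using reals_Archimedean2 by blast
  have "K * d / (real M + 1) < e / 2" if "M0 \<le> M" for M
  proof -
    have "2 * K * d / e < real M + 1" using M0 that by linarith
    then show ?thesis using e by (simp add: field_simps)
  qed
  then show "\<exists>M0. \<forall>M\<ge>M0. cmod ((CLINT x:unit_cube d|lebesgue_vec d. f x * of_real (kernel d M x0 x)) - f x0) < e"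
    using bound by (intro exI[of _ M0]) (smt (verit, best) field_sum_of_halves)
qed

section \<open>Fejer means of the Fourier series and inversion\<close>

definition fejer_weight :: "nat \<Rightarrow> nat \<Rightarrow> (nat \<Rightarrow> int) \<Rightarrow> real" where
  "fejer_weight d M k = (\<Prod>j<d. max 0 (1 - real_of_int \<bar>k j\<bar> / (real M + 1)))"

lemma chr_prod: "chr d k x = (\<Prod>j<d. cis (2 * pi * (real_of_int (k j) * x j)))"
  unfolding chr_def sum_distrib_left by (induction d) (auto simp: cis_mult[symmetric])

lemma chr_measurable [measurable]: "chr d k \<in> borel_measurable (lebesgue_vec d)"
  unfolding chr_def cis_conv_exp by measurable

lemma cnj_chr: "cnj (chr d k x) = chr d (\<lambda>j. - k j) x"
  by (simp add: chr_def cis_cnj sum_negf)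

lemma chr_diff: "chr d k (\<lambda>j. x j - y j) = chr d k x * cnj (chr d k y)"
  by (simp add: chr_def cis_cnj cis_mult right_diff_distrib sum_subtractf)

lemma kernel_expansion:
  "complex_of_real (kernel d M x0 x) =
     (\<Sum>k\<in>(\<Pi>\<^sub>E j\<in>{..<d}. {-int M..int M}). of_real (fejer_weight d M k) * (chr d k x0 * cnj (chr d k x)))"
proof -
  \<comment> \<open>Inside the box the truncation by \<open>max 0\<close> changes nothing; outside
    it makes the weight vanish, so that one formula serves for all frequencies.\<close>
  have w: "1 - real_of_int \<bar>k\<bar> / (real M + 1) = max 0 (1 - real_of_int \<bar>k\<bar> / (real M + 1))"
    if "k \<in> {-int M..int M}" for k
  proof -
    have "real_of_int \<bar>k\<bar> \<le> real M + 1" using that by auto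
    then show ?thesis by (simp add: max_def divide_le_eq)
  qed
  have "complex_of_real (kernel d M x0 x) = (\<Prod>j<d. \<Sum>k\<in>{-int M..int M}.
      of_real (max 0 (1 - real_of_int \<bar>k\<bar> / (real M + 1))) * cis (2 * pi * (real_of_int k * (x0 j - x j))))"
    unfolding kernel_def of_real_prod fejer_expansion
    by (intro prod.cong sum.cong refl) (metis w)
  also have "\<dots> = (\<Sum>k\<in>(\<Pi>\<^sub>E j\<in>{..<d}. {-int M..int M}). \<Prod>j<d.
      of_real (max 0 (1 - real_of_int \<bar>k j\<bar> / (real M + 1))) * cis (2 * pi * (real_of_int (k j) * (x0 j - x j))))"
    by (rule prod_sum_PiE) auto
  also have "\<dots> = (\<Sum>k\<in>(\<Pi>\<^sub>E j\<in>{..<d}. {-int M..int M}). of_real (fejer_weight d M k) * chr d k (\<lambda>j. x0 j - x j))"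
    by (intro sum.cong refl) (simp add: fejer_weight_def chr_prod prod.distrib)
  finally show ?thesis by (simp add: chr_diff)
qed

text \<open>The finite sum over the box is written as a sum over all of \<open>ZVec d\<close>. An
  index set that does not move with \<open>M\<close> is what
  \<open>infsum_dominated_convergence\<close> requires.\<close>

lemma fejer_mean_expansion:
  assumes f: "continuous_torus d f"
  shows "(CLINT x:unit_cube d|lebesgue_vec d. f x * of_real (kernel d M x0 x)) =
     (\<Sum>\<^sub>\<infinity>k\<in>ZVec d. of_real (fejer_weight d M k) * (fourier_coeff d f k * chr d k x0))"
proof -
  let ?box = "(\<Pi>\<^sub>E j\<in>{..<d}. {-int M..int M})"
  obtain B where B: "0 < B" "\<And>x. x \<in> unit_cube d \<Longrightarrow> cmod (f x) \<le> B"
    using torus_bounded[OF f] by blast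
  have [measurable]: "f \<in> borel_measurable (lebesgue_vec d)"
    using torus_measurable[OF f] .
  have int: "set_integrable (lebesgue_vec d) (unit_cube d) (\<lambda>x. f x * cnj (chr d k x))" for k
  proof (rule set_integrable_unit_cube)
    show "(\<lambda>x. f x * cnj (chr d k x)) \<in> borel_measurable (lebesgue_vec d)"
      unfolding cnj_chr by measurable
  qed (use B in \<open>auto simp: norm_mult\<close>)
  have "(CLINT x:unit_cube d|lebesgue_vec d. f x * of_real (kernel d M x0 x)) =
     (CLINT x:unit_cube d|lebesgue_vec d. (\<Sum>k\<in>?box. (of_real (fejer_weight d M k) * chr d k x0) * (f x * cnj (chr d k x))))"
    unfolding kernel_expansion by (simp add: sum_distrib_left mult_ac)
  also have "\<dots> = (\<Sum>k\<in>?box. CLINT x:unit_cube d|lebesgue_vec d. (of_real (fejer_weight d M k) * chr d k x0) * (f x * cnj (chr d k x)))"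
    unfolding set_lebesgue_integral_def scaleR_sum_right
    using int by (intro Bochner_Integration.integral_sum)
      (simp add: set_integrable_def mult_scaleR_right[symmetric] del: mult_scaleR_right)
  also have "\<dots> = (\<Sum>k\<in>?box. of_real (fejer_weight d M k) * (fourier_coeff d f k * chr d k x0))"
    by (simp add: fourier_coeff_chr mult.assoc) (simp add: mult.commute)
  also have "\<dots> = (\<Sum>\<^sub>\<infinity>k\<in>?box. of_real (fejer_weight d M k) * (fourier_coeff d f k * chr d k x0))"
    by (rule infsum_finite[symmetric]) (auto intro!: finite_PiE)
  also have "\<dots> = (\<Sum>\<^sub>\<infinity>k\<in>ZVec d. of_real (fejer_weight d M k) * (fourier_coeff d f k * chr d k x0))"
  proof (rule infsum_cong_neutral)
    fix k assume "k \<in> ZVec d - ?box"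
    then obtain j where j: "j < d" "k j \<notin> {-int M..int M}"
      by (auto simp: ZVec_def PiE_def Pi_iff)
    then have "real M + 1 \<le> real_of_int \<bar>k j\<bar>"
      by auto
    then have "max 0 (1 - real_of_int \<bar>k j\<bar> / (real M + 1)) = 0"
      by (simp add: max_def le_divide_eq)
    then have "fejer_weight d M k = 0"
      unfolding fejer_weight_def using j(1) by (intro prod_zero) auto
    then show "of_real (fejer_weight d M k) * (fourier_coeff d f k * chr d k x0) = 0"
      by simp
  qed (auto simp: ZVec_def PiE_def)
  finally show ?thesis .
qed

text \<open>The Fejer means have two limits: the value \<open>f x0\<close>, by the approximate
  identity, and the Fourier series, by dominated convergence, since the weights lie in [0, 1] and
  tend to 1 for each fixed frequency.\<close>

theorem fourier_inversion:
  assumes f: "continuous_torus d f"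
    and summable: "(\<lambda>k. cmod (fourier_coeff d f k)) summable_on ZVec d"
    and x0: "x0 \<in> unit_cube d"
  shows "f x0 = (\<Sum>\<^sub>\<infinity>k\<in>ZVec d. fourier_coeff d f k * chr d k x0)"
proof -
  have "(\<lambda>M. \<Sum>\<^sub>\<infinity>k\<in>ZVec d. of_real (fejer_weight d M k) * (fourier_coeff d f k * chr d k x0))
      \<longlonglongrightarrow> (\<Sum>\<^sub>\<infinity>k\<in>ZVec d. fourier_coeff d f k * chr d k x0)"
  proof (rule infsum_dominated_convergence)
    show "(\<lambda>k. cmod (fourier_coeff d f k * chr d k x0)) summable_on ZVec d"
      using summable by (simp add: norm_mult)
    fix k
    have "\<bar>fejer_weight d M k\<bar> \<le> (\<Prod>j<d. 1)" for M
      unfolding fejer_weight_def abs_prod by (intro prod_mono) (auto simp: max_def)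
    then show "\<bar>fejer_weight d M k\<bar> \<le> 1" for M by simp
    have "(\<lambda>M. a / (real M + 1)) \<longlonglongrightarrow> 0" for a :: real
      using LIMSEQ_Suc[OF lim_const_over_n[of a]] by (simp add: add.commute)
    then have "(\<lambda>M. max 0 (1 - real_of_int \<bar>k j\<bar> / (real M + 1))) \<longlonglongrightarrow> max 0 (1 - 0)" for j
      by (intro tendsto_intros)
    then have "(\<lambda>M. fejer_weight d M k) \<longlonglongrightarrow> (\<Prod>j<d. 1)"
      unfolding fejer_weight_def by (intro tendsto_prod) simp
    then show "(\<lambda>M. fejer_weight d M k) \<longlonglongrightarrow> 1" by simp
  qed
  moreover have "(\<lambda>M. \<Sum>\<^sub>\<infinity>k\<in>ZVec d. of_real (fejer_weight d M k) * (fourier_coeff d f k * chr d k x0)) \<longlonglongrightarrow> f x0"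
    using kernel_approximation[OF f x0] by (simp add: fejer_mean_expansion[OF f])
  ultimately show ?thesis
    by (rule LIMSEQ_unique[rotated])
qed

section \<open>Gaussian exponential sums\<close>

definition expsum :: "real \<Rightarrow> int \<Rightarrow> real \<Rightarrow> complex" where
  "expsum r L \<theta> = (\<Sum>l\<in>{-L..L}. of_real (gauss_weight r l) * cis (- 2 * pi * (real_of_int l * \<theta>)))"

lemma roots_of_unity_sum:
  fixes N :: nat and m :: int
  assumes N: "0 < N"
  shows "(\<Sum>a<N. cis (2 * pi * (real_of_int m * (real a / real N)))) =
     (if int N dvd m then of_nat N else 0)"
proof -
  let ?w = "cis (2 * pi * (real_of_int m / real N))"
  have pw: "cis (2 * pi * (real_of_int m * (real a / real N))) = ?w ^ a" for a
    by (simp add: Complex.DeMoivre field_simps)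
  have wN: "?w ^ N = 1"
    unfolding Complex.DeMoivre using N cis_multiple_2pi[of "of_int m"] by (simp add: field_simps)
  have w1: "?w = 1 \<longleftrightarrow> int N dvd m"
  proof
    assume "?w = 1"
    then have "cos (2 * pi * (real_of_int m / real N)) = 1"
      by (metis cis.sel(1) one_complex.sel(1))
    then obtain n :: int where "2 * pi * (real_of_int m / real N) = real_of_int n * 2 * pi"
      using cos_one_2pi_int by blast
    then have "real_of_int m = real_of_int (n * int N)"
      using N by (simp add: field_simps)
    then have "m = n * int N"
      by (rule of_int_eq_iff[THEN iffD1])
    then show "int N dvd m" by simp
  next
    assume "int N dvd m"
    then obtain n where "m = int N * n" ..
    then show "?w = 1"
      using N cis_multiple_2pi[of "of_int n"] by simp
  qed
  show ?thesis
  proof (cases "int N dvd m")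
    case True
    then have "?w = 1" using w1 by simp
    then show ?thesis unfolding pw using True by simp
  next
    case False
    then have "?w \<noteq> 1" using w1 by simp
    then have "(\<Sum>a<N. ?w ^ a) = 0"
      unfolding geometric_sum[OF \<open>?w \<noteq> 1\<close>] wN by simp
    then show ?thesis unfolding pw using False by simp
  qed
qed

text \<open>After expanding the square, \<open>roots_of_unity_sum\<close> removes every pair of
  indices that differ modulo \<open>N\<close>, so only the diagonal is left when \<open>A\<close>
  has no two congruent elements. In both applications this comes from \<open>N\<close> exceeding the
  spread of the index range.\<close>

lemma parseval_mod:
  fixes c :: "int \<Rightarrow> complex"
  assumes N: "0 < N" and fin: "finite A"
    and inj: "\<And>l l'. l \<in> A \<Longrightarrow> l' \<in> A \<Longrightarrow> int N dvd l' - l \<Longrightarrow> l = l'"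
  shows "(\<Sum>a<N. (cmod (\<Sum>l\<in>A. c l * cis (- 2 * pi * (real_of_int l * (real a / real N)))))\<^sup>2) =
     real N * (\<Sum>l\<in>A. (cmod (c l))\<^sup>2)"
proof -
  let ?e = "\<lambda>m a. cis (2 * pi * (real_of_int m * (real a / real N)))"
  have e_split: "?e (l' - l) a = cis (- 2 * pi * (real_of_int l * (real a / real N)))
      * cnj (cis (- 2 * pi * (real_of_int l' * (real a / real N))))" for l l' a
    unfolding cis_cnj cis_mult by (rule arg_cong[where f = cis]) (simp add: algebra_simps diff_divide_distrib)
  have "complex_of_real (\<Sum>a<N. (cmod (\<Sum>l\<in>A. c l * cis (- 2 * pi * (real_of_int l * (real a / real N)))))\<^sup>2)
     = (\<Sum>a<N. \<Sum>l\<in>A. \<Sum>l'\<in>A. c l * cnj (c l') * ?e (l' - l) a)"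
    unfolding of_real_sum complex_norm_square e_split sum_product cnj_sum complex_cnj_mult
    by (intro sum.cong refl) (simp only: mult_ac)
  also have "\<dots> = (\<Sum>l\<in>A. \<Sum>l'\<in>A. \<Sum>a<N. c l * cnj (c l') * ?e (l' - l) a)"
    by (subst sum.swap) (intro sum.cong refl sum.swap)
  also have "\<dots> = (\<Sum>l\<in>A. \<Sum>l'\<in>A. if l' = l then of_nat N * (c l * cnj (c l)) else 0)"
  proof (intro sum.cong refl)
    fix l l' assume l: "l \<in> A" "l' \<in> A"
    have "(\<Sum>a<N. c l * cnj (c l') * ?e (l' - l) a) = c l * cnj (c l') * (\<Sum>a<N. ?e (l' - l) a)"
      by (rule sum_distrib_left[symmetric])
    also have "\<dots> = (if l' = l then of_nat N * (c l * cnj (c l)) else 0)"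
      unfolding roots_of_unity_sum[OF N] using inj[OF l] by auto
    finally show "(\<Sum>a<N. c l * cnj (c l') * ?e (l' - l) a) = (if l' = l then of_nat N * (c l * cnj (c l)) else 0)" .
  qed
  also have "\<dots> = (\<Sum>l\<in>A. of_nat N * (c l * cnj (c l)))"
    using fin by simp
  also have "\<dots> = complex_of_real (real N * (\<Sum>l\<in>A. (cmod (c l))\<^sup>2))"
    by (simp add: complex_norm_square sum_distrib_left flip: of_real_power)
  finally show ?thesis
    by (simp only: of_real_eq_iff)
qed

section \<open>Total mass of the Gaussian weights\<close>

lemma gauss_weight_normal: "0 < r \<Longrightarrow> gauss_weight r l = normal_density 0 r (real_of_int l)"
  by (simp add: gauss_weight_def normal_density_def real_sqrt_mult mult_ac)

lemma gauss_weight_pos: "0 < r \<Longrightarrow> 0 < gauss_weight r l"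
  by (simp add: gauss_weight_def)

lemma gauss_weight_minus [simp]: "gauss_weight r (- l) = gauss_weight r l"
  by (simp add: gauss_weight_def)

lemma normal_density_antimono:
  assumes "0 < r" "\<bar>x\<bar> \<le> \<bar>y\<bar>"
  shows "normal_density 0 r y \<le> normal_density 0 r x"
proof -
  have "x\<^sup>2 \<le> y\<^sup>2" using assms(2) by (simp add: abs_le_square_iff)
  then show ?thesis
    using assms(1) by (simp add: normal_density_def divide_right_mono)
qed

lemma gauss_weight_zero_le: "0 < r \<Longrightarrow> gauss_weight r 0 \<le> 1 / (2 * r)"
proof -
  assume r: "0 < r"
  have "2 = sqrt (2 * 2)" by simp
  also have "\<dots> \<le> sqrt (2 * pi)" using pi_gt3 by (intro real_sqrt_le_mono) simp
  finally show ?thesis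
    using r by (simp add: gauss_weight_def field_simps)
qed

lemma sum_symmetric_interval_Suc:
  "(\<Sum>l\<in>{-int (Suc m)..int (Suc m)}. h l) = (\<Sum>l\<in>{-int m..int m}. h l) + h (int (Suc m)) + h (- int (Suc m) :: int)"
  for h :: "int \<Rightarrow> 'a::comm_monoid_add"
proof -
  have "{-int (Suc m)..int (Suc m)} = insert (-int (Suc m)) (insert (int (Suc m)) {-int m..int m})"
    by auto
  then show ?thesis by (simp add: add_ac)
qed

lemma gauss_sum_integral:
  assumes r: "0 < r"
  shows "\<bar>(\<Sum>l\<in>{-int m..int m}. gauss_weight r l) - integral {-real m..real m} (normal_density 0 r)\<bar> \<le> gauss_weight r 0"
proof -
  let ?\<phi> = "normal_density 0 r"
  let ?G = "\<lambda>m. gauss_weight r (int m)"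
  have int: "?\<phi> integrable_on {a..b}" for a b :: real
    unfolding normal_density_def by (intro integrable_continuous_real continuous_intros) (use r in auto)
  have cell: "?G (Suc m) \<le> integral {a..a+1} ?\<phi> \<and> integral {a..a+1} ?\<phi> \<le> ?G m"
    if a: "a = real m \<or> a = - real m - 1" for a m
  proof
    have "integral {a..a+1} (\<lambda>_. ?G (Suc m)) \<le> integral {a..a+1} ?\<phi>"
    proof (rule integral_le[OF _ int])
      fix x assume "x \<in> {a..a+1}"
      then have "\<bar>x\<bar> \<le> \<bar>real (Suc m)\<bar>" using a by auto
      then show "?G (Suc m) \<le> ?\<phi> x"
        unfolding gauss_weight_normal[OF r] of_int_of_nat_eq by (rule normal_density_antimono[OF r])
    qed auto
    then show "?G (Suc m) \<le> integral {a..a+1} ?\<phi>" by simp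
    have "integral {a..a+1} ?\<phi> \<le> integral {a..a+1} (\<lambda>_. ?G m)"
    proof (rule integral_le[OF int])
      fix x assume "x \<in> {a..a+1}"
      then have "\<bar>real m\<bar> \<le> \<bar>x\<bar>" using a by auto
      then show "?\<phi> x \<le> ?G m"
        unfolding gauss_weight_normal[OF r] of_int_of_nat_eq by (rule normal_density_antimono[OF r])
    qed auto
    then show "integral {a..a+1} ?\<phi> \<le> ?G m" by simp
  qed
  have step: "integral {-real (Suc m)..real (Suc m)} ?\<phi> =
      integral {-real m - 1..(-real m - 1) + 1} ?\<phi> + integral {-real m..real m} ?\<phi> + integral {real m..real m + 1} ?\<phi>" for m
  proof -
    have "integral {-real (Suc m)..-real m} ?\<phi> + integral {-real m..real (Suc m)} ?\<phi> = integral {-real (Suc m)..real (Suc m)} ?\<phi>"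
      by (rule Henstock_Kurzweil_Integration.integral_combine[OF _ _ int]) auto
    moreover have "integral {-real m..real m} ?\<phi> + integral {real m..real (Suc m)} ?\<phi> = integral {-real m..real (Suc m)} ?\<phi>"
      by (rule Henstock_Kurzweil_Integration.integral_combine[OF _ _ int]) auto
    ultimately show ?thesis by (simp add: add.commute[of 1])
  qed
  \<comment> \<open>The upper half is stronger than the claim by \<open>2 * ?G m\<close>, which
    makes the induction close: the two new cells add at most \<open>2 * ?G m\<close> to the
    integral, whereas the sum gains \<open>2 * ?G (Suc m)\<close>.\<close>
  have "(\<Sum>l\<in>{-int m..int m}. gauss_weight r l) - gauss_weight r 0 \<le> integral {-real m..real m} ?\<phi> \<and>
     integral {-real m..real m} ?\<phi> \<le> (\<Sum>l\<in>{-int m..int m}. gauss_weight r l) + gauss_weight r 0 - 2 * ?G m"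
  proof (induction m)
    case 0
    then show ?case by simp
  next
    case (Suc m)
    have "gauss_weight r (- int (Suc m)) = ?G (Suc m)"
      by (rule gauss_weight_minus)
    then show ?case
      using Suc cell[of "real m" m] cell[of "-real m - 1" m]
      unfolding sum_symmetric_interval_Suc step by linarith
  qed
  then show ?thesis
    using gauss_weight_pos[OF r, of "int m"] by linarith
qed

lemma normal_integral_bounds:
  assumes r: "0 < r"
  shows "integral {-real m..real m} (normal_density 0 r) \<le> 1"
    and "1 - 2 * exp (- ((real m)\<^sup>2 / (2 * r\<^sup>2))) \<le> integral {-real m..real m} (normal_density 0 r)"
proof -
  let ?\<phi> = "normal_density 0 r"
  let ?q = "exp (- ((real m)\<^sup>2 / (2 * r\<^sup>2)))"
  have si: "set_integrable lborel {-real m..real m} ?\<phi>"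
    using integrable_normal_density[OF r] unfolding set_integrable_def
    by (intro integrable_mult_indicator) auto
  have eq: "integral {-real m..real m} ?\<phi> = (LINT x:{-real m..real m}|lborel. ?\<phi> x)"
    using set_borel_integral_eq_integral(2)[OF si] by simp
  have "(LINT x:{-real m..real m}|lborel. ?\<phi> x) \<le> (LINT x|lborel. ?\<phi> x)"
    unfolding set_lebesgue_integral_def
    by (rule integral_mono[OF si[unfolded set_integrable_def] integrable_normal_density[OF r]])
       (auto simp: indicator_def)
  then show "integral {-real m..real m} ?\<phi> \<le> 1"
    using eq integral_normal_density[OF r] by simp
  \<comment> \<open>For \<open>x\<close> beyond \<open>s = m\<close> or \<open>s = -m\<close> one
    has \<open>x^2 \<ge> m^2 + (x - s)^2\<close>. So each tail lies below \<open>?q\<close> times a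
    Gaussian centred at \<open>s\<close>, and costs at most \<open>?q\<close> because that Gaussian
    has total mass 1.\<close>
  have shift: "?\<phi> x \<le> ?q * normal_density s r x" if "s\<^sup>2 = (real m)\<^sup>2" "0 \<le> s * (x - s)" for s x
  proof -
    have "(real m)\<^sup>2 + (x - s)\<^sup>2 \<le> x\<^sup>2"
      using that by (simp add: power2_eq_square algebra_simps)
    then have "exp (- x\<^sup>2 / (2 * r\<^sup>2)) \<le> exp (- ((real m)\<^sup>2 / (2 * r\<^sup>2)) + - (x - s)\<^sup>2 / (2 * r\<^sup>2))"
      using r by (simp add: field_simps)
    then show ?thesis
      unfolding exp_add normal_density_def using r by (simp add: divide_right_mono)
  qed
  have pw: "?\<phi> x \<le> indicator {-real m..real m} x *\<^sub>R ?\<phi> x + (?q * normal_density (real m) r x + ?q * normal_density (- real m) r x)" for x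
  proof -
    have nn: "0 \<le> normal_density s r x" for s by (rule normal_density_nonneg)
    consider "x \<in> {-real m..real m}" | "real m < x" | "x < - real m" by force
    then show ?thesis
    proof cases
      case 1
      then show ?thesis using nn by simp
    next
      case 2
      then show ?thesis
        using shift[of "real m" x] mult_nonneg_nonneg[of ?q, OF _ nn[of "- real m"]] by (auto simp: add_increasing2)
    next
      case 3
      then show ?thesis
        using shift[of "- real m" x] mult_nonneg_nonneg[of ?q, OF _ nn[of "real m"]]
        by (auto simp: mult_nonneg_nonpos add_increasing)
    qed
  qed
  have i2: "integrable lborel (\<lambda>x. ?q * normal_density (real m) r x + ?q * normal_density (- real m) r x)"
    using r by (intro Bochner_Integration.integrable_add integrable_mult_right integrable_normal_density)
  have "(LINT x|lborel. ?\<phi> x) \<le> (LINT x|lborel. indicator {-real m..real m} x *\<^sub>R ?\<phi> x + (?q * normal_density (real m) r x + ?q * normal_density (- real m) r x))"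
    by (rule integral_mono[OF integrable_normal_density[OF r] Bochner_Integration.integrable_add[OF si[unfolded set_integrable_def] i2] pw])
  also have "\<dots> = (LINT x:{-real m..real m}|lborel. ?\<phi> x) + (?q + ?q)"
    using r si i2 integral_normal_density[OF r]
    by (subst Bochner_Integration.integral_add)
      (auto simp: set_lebesgue_integral_def set_integrable_def)
  finally show "1 - 2 * ?q \<le> integral {-real m..real m} ?\<phi>"
    using eq integral_normal_density[OF r] by simp
qed

lemma gauss_sum_near_one:
  assumes r: "0 < r" and L: "0 \<le> L"
  shows "\<bar>(\<Sum>l\<in>{-L..L}. gauss_weight r l) - 1\<bar> \<le> 1 / (2 * r) + 2 * exp (- ((real_of_int L)\<^sup>2 / (2 * r\<^sup>2)))"
  using gauss_sum_integral[OF r, of "nat L"] normal_integral_bounds[OF r, of "nat L"] L gauss_weight_zero_le[OF r]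
  by (simp add: abs_le_iff)

section \<open>Reciprocal weights on the grid of multiples of 1/N\<close>

lemma sum_inverse_quadratic_le:
  assumes \<beta>: "0 < \<beta>"
  shows "(\<Sum>a\<le>N. 1 / (1 + (\<beta> * real a)\<^sup>2)) \<le> 1 + pi / (2 * \<beta>)"
proof -
  \<comment> \<open>An integral comparison phrased with the antiderivative: the mean value theorem
    for \<open>arctan\<close> on one cell, whose derivative is smallest at the right endpoint. The
    sum of these bounds telescopes.\<close>
  have step: "1 / (1 + (\<beta> * real (Suc a))\<^sup>2) \<le> (arctan (\<beta> * real (Suc a)) - arctan (\<beta> * real a)) / \<beta>" for a
  proof -
    have "\<beta> * real a < \<beta> * real (Suc a)" using \<beta> by simp
    then obtain z where z: "\<beta> * real a < z" "z < \<beta> * real (Suc a)"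
      "arctan (\<beta> * real (Suc a)) - arctan (\<beta> * real a) = (\<beta> * real (Suc a) - \<beta> * real a) * inverse (1 + z\<^sup>2)"
      using MVT2[of "\<beta> * real a" "\<beta> * real (Suc a)" arctan "\<lambda>z. inverse (1 + z\<^sup>2)"] DERIV_arctan by metis
    have "0 \<le> z" using z(1) \<beta> by (smt (verit) mult_nonneg_nonneg of_nat_0_le_iff)
    then have "z\<^sup>2 \<le> (\<beta> * real (Suc a))\<^sup>2" using z(2) by (intro power_mono) auto
    then have "inverse (1 + (\<beta> * real (Suc a))\<^sup>2) \<le> inverse (1 + z\<^sup>2)"
      by (intro le_imp_inverse_le) (auto simp: add_pos_nonneg)
    moreover have "\<beta> * real (Suc a) - \<beta> * real a = \<beta>"
      by (simp add: algebra_simps)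
    then have "(arctan (\<beta> * real (Suc a)) - arctan (\<beta> * real a)) / \<beta> = inverse (1 + z\<^sup>2)"
      unfolding z(3) using \<beta> by simp
    ultimately show ?thesis by (simp add: inverse_eq_divide)
  qed
  have "(\<Sum>a\<le>N. 1 / (1 + (\<beta> * real a)\<^sup>2)) \<le> 1 + arctan (\<beta> * real N) / \<beta>"
  proof (induction N)
    case (Suc N)
    then show ?case using step[of N] by (simp add: diff_divide_distrib)
  qed simp
  also have "\<dots> \<le> 1 + (pi / 2) / \<beta>"
    using \<beta> arctan_ubound[of "\<beta> * real N"] by (intro add_left_mono divide_right_mono) auto
  finally show ?thesis by simp
qed

text \<open>The sharp slope would be \<open>2 / pi\<close>. The slope \<open>1 / 3\<close> suffices
  because it meets \<open>pi > 3\<close> below and gives \<open>sin (pi * x) \<ge> x\<close> for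
  \<open>0 \<le> x \<le> 1/2\<close>.\<close>

lemma sin_ge_third:
  assumes "0 \<le> x" "x \<le> pi / 2"
  shows "x / 3 \<le> sin x"
proof (cases "x \<le> pi / 3")
  case True
  show ?thesis
  proof (cases "x = 0")
    case False
    then have "0 < x" using assms by simp
    then obtain z where z: "0 < z" "z < x" "sin x - sin 0 = (x - 0) * cos z"
      using MVT2[of 0 x sin cos] DERIV_sin by blast
    have "cos (pi / 3) \<le> cos z"
      using z True by (intro cos_monotone_0_pi_le) auto
    then have "x * (1 / 2) \<le> x * cos z"
      using \<open>0 < x\<close> by (intro mult_left_mono) (auto simp: cos_60)
    then show ?thesis using z(3) \<open>0 < x\<close> by simp
  qed simp
next
  case False
  have "sin (pi / 3) \<le> sin x"
    using assms False pi_gt_zero by (intro sin_monotone_2pi_le) auto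
  moreover have "sqrt ((4 / 3)\<^sup>2) \<le> sqrt 3"
    by (intro real_sqrt_le_mono) (simp add: power2_eq_square)
  ultimately show ?thesis
    using assms(2) pi_less_4 by (simp add: sin_60)
qed

text \<open>Since \<open>|1 - e(a/N)| = 2 * |sin (pi * a / N)|\<close> is at least
  \<open>2 * a / N\<close> up to the midpoint, the summand is compared with an inverse quadratic of
  slope \<beta> = 2r/N. The symmetry \<open>a -> N - a\<close> covers the other half at the price of
  a second copy of the sum, and \<open>3 * r \<le> N\<close> absorbs the additive 2.\<close>

lemma sum_inverse_weight_le:
  assumes r: "0 < r" and N: "0 < N" "3 * r \<le> real N"
  shows "(\<Sum>a<N. 1 / (1 + r\<^sup>2 * (cmod (1 - cis (2 * pi * (real a / real N))))\<^sup>2)) \<le> 3 * real N / r"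
proof -
  define \<beta> where "\<beta> = 2 * r / real N"
  let ?p = "\<lambda>a. 1 / (1 + (\<beta> * real a)\<^sup>2)"
  have \<beta>: "0 < \<beta>" using r N by (simp add: \<beta>_def)
  have p0: "0 \<le> ?p a" for a by (simp add: add_nonneg_nonneg)
  have key: "1 / (1 + r\<^sup>2 * (4 * (sin (pi * (real a / real N)))\<^sup>2)) \<le> ?p a" if "2 * a \<le> N" for a
  proof -
    have "pi * (real a / real N) \<le> pi * (1 / 2)"
      using that N by (intro mult_left_mono) (auto simp: field_simps)
    then have "pi * (real a / real N) / 3 \<le> sin (pi * (real a / real N))"
      by (intro sin_ge_third) auto
    moreover have "real a / real N \<le> pi * (real a / real N) / 3"
      using mult_right_mono[of 3 pi "real a / real N"] pi_gt3 by simp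
    ultimately have "real a / real N \<le> sin (pi * (real a / real N))"
      by linarith
    then have "(real a / real N)\<^sup>2 \<le> (sin (pi * (real a / real N)))\<^sup>2"
      by (rule power_mono) simp
    then have "4 * r\<^sup>2 * (real a / real N)\<^sup>2 \<le> 4 * r\<^sup>2 * (sin (pi * (real a / real N)))\<^sup>2"
      by (rule mult_left_mono) simp
    then have "(\<beta> * real a)\<^sup>2 \<le> r\<^sup>2 * (4 * (sin (pi * (real a / real N)))\<^sup>2)"
      by (simp add: \<beta>_def power_mult_distrib power_divide)
    then show ?thesis
      by (intro divide_left_mono) (auto intro!: add_pos_nonneg mult_pos_pos)
  qed
  have "1 / (1 + r\<^sup>2 * (cmod (1 - cis (2 * pi * (real a / real N))))\<^sup>2) \<le> ?p a + ?p (N - a)" if a: "a < N" for a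
  proof (cases "2 * a \<le> N")
    case True
    then show ?thesis
      unfolding cmod_one_minus_cis using key[OF True] p0[of "N - a"] by linarith
  next
    case False
    have "pi * (real (N - a) / real N) = pi - pi * (real a / real N)"
      using a by (simp add: of_nat_diff field_simps)
    then have s: "sin (pi * (real (N - a) / real N)) = sin (pi * (real a / real N))"
      by simp
    have "2 * (N - a) \<le> N" using False by simp
    from key[OF this] show ?thesis
      unfolding cmod_one_minus_cis s using p0[of a] by linarith
  qed
  then have "(\<Sum>a<N. 1 / (1 + r\<^sup>2 * (cmod (1 - cis (2 * pi * (real a / real N))))\<^sup>2)) \<le> (\<Sum>a<N. ?p a) + (\<Sum>a<N. ?p (N - a))"
    unfolding sum.distrib[symmetric] by (intro sum_mono) auto
  also have "(\<Sum>a<N. ?p (N - a)) = (\<Sum>a\<in>{1..N}. ?p a)"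
    by (rule sum.reindex_bij_witness[where i = "\<lambda>a. N - a" and j = "\<lambda>a. N - a"]) auto
  also have "(\<Sum>a<N. ?p a) + (\<Sum>a\<in>{1..N}. ?p a) \<le> (\<Sum>a\<le>N. ?p a) + (\<Sum>a\<le>N. ?p a)"
    by (intro add_mono sum_mono2) (auto simp: p0)
  also have "\<dots> \<le> 2 * (1 + pi / (2 * \<beta>))"
    using sum_inverse_quadratic_le[OF \<beta>, of N] by simp
  also have "\<dots> = 2 + pi / 2 * (real N / r)"
    using r N by (simp add: \<beta>_def field_simps)
  also have "\<dots> \<le> 2 / 3 * (real N / r) + 2 * (real N / r)"
    using r N pi_less_4 by (intro add_mono mult_right_mono) (auto simp: field_simps)
  also have "\<dots> \<le> 3 * real N / r"
    using r by (simp add: field_simps)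
  finally show ?thesis .
qed

section \<open>Differences of the weights and the averaged exponential sum\<close>

lemma gauss_weight_step:
  assumes r: "1 \<le> r"
  shows "gauss_weight r (int m) - gauss_weight r (int (Suc m)) \<le> 3 / 2 * gauss_weight r 0 / r"
proof -
  let ?G0 = "gauss_weight r 0" and ?x = "real m / r"
  have G: "gauss_weight r (int k) = ?G0 * exp (- ((real k)\<^sup>2 / (2 * r\<^sup>2)))" for k
    by (simp add: gauss_weight_def)
  have G0: "0 < ?G0" using r by (simp add: gauss_weight_pos)
  have "(real (Suc m))\<^sup>2 / (2 * r\<^sup>2) = (real m)\<^sup>2 / (2 * r\<^sup>2) + (2 * real m + 1) / (2 * r\<^sup>2)"
    by (simp add: add_divide_distrib[symmetric] power2_eq_square algebra_simps)
  then have "gauss_weight r (int m) - gauss_weight r (int (Suc m)) =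
     ?G0 * exp (- ((real m)\<^sup>2 / (2 * r\<^sup>2))) * (1 - exp (- ((2 * real m + 1) / (2 * r\<^sup>2))))"
    unfolding G by (simp add: exp_add[symmetric] algebra_simps)
  also have "\<dots> \<le> ?G0 * exp (- ((real m)\<^sup>2 / (2 * r\<^sup>2))) * ((2 * real m + 1) / (2 * r\<^sup>2))"
    using exp_ge_add_one_self[of "- ((2 * real m + 1) / (2 * r\<^sup>2))"] G0 by (intro mult_left_mono) auto
  also have "\<dots> = ?G0 / (2 * r\<^sup>2) * (2 * (real m * exp (- ((real m)\<^sup>2 / (2 * r\<^sup>2)))) + exp (- ((real m)\<^sup>2 / (2 * r\<^sup>2))))"
    by (simp add: field_simps)
  also have "\<dots> \<le> ?G0 / (2 * r\<^sup>2) * (2 * r + r)"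
  proof (intro mult_left_mono add_mono)
    \<comment> \<open>This gives \<open>x * exp (- x^2 / 2) \<le> 1\<close> at
      \<open>x = m / r\<close>, through \<open>x \<le> 1 + x^2 / 2 \<le> exp (x^2 / 2)\<close>: the
      slope of the Gaussian is at most its peak divided by \<open>r\<close>.\<close>
    have "y \<le> 1 + y\<^sup>2 / 2" for y :: real
      using zero_le_power2[of "y - 1"] by (simp add: power2_diff)
    then have "?x \<le> 1 + ?x\<^sup>2 / 2" .
    also have "\<dots> \<le> exp (?x\<^sup>2 / 2)"
      by (rule exp_ge_add_one_self)
    finally have "?x * exp (- (?x\<^sup>2 / 2)) \<le> exp (?x\<^sup>2 / 2) * exp (- (?x\<^sup>2 / 2))"
      by (rule mult_right_mono) simp
    also have "\<dots> = 1" by (simp add: exp_minus)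
    finally have "?x * exp (- ((real m)\<^sup>2 / (2 * r\<^sup>2))) \<le> 1"
      by (simp add: power_divide mult.commute)
    then show "real m * exp (- ((real m)\<^sup>2 / (2 * r\<^sup>2))) \<le> r"
      using r by (simp add: field_simps)
    have "exp (- ((real m)\<^sup>2 / (2 * r\<^sup>2))) \<le> 1" by simp
    then show "exp (- ((real m)\<^sup>2 / (2 * r\<^sup>2))) \<le> r" using r by linarith
  qed (use G0 in auto)
  also have "\<dots> = 3 / 2 * ?G0 / r"
    using r by (simp add: power2_eq_square field_simps)
  finally show ?thesis .
qed

text \<open>One factor of each square is bounded by the largest step, the other telescopes. The
  steps on the two sides of 0 contribute equally, which doubles 3/2 to 3. The range
  \<open>{1 - m..m}\<close> lists exactly the unit steps inside \<open>[-m, m]\<close>.\<close>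

lemma sum_gauss_step_squares:
  assumes r: "1 \<le> r"
  shows "(\<Sum>l\<in>{1 - int m..int m}. (gauss_weight r l - gauss_weight r (l - 1))\<^sup>2)
     \<le> 3 * gauss_weight r 0 / r * (gauss_weight r 0 - gauss_weight r (int m))"
proof (induction m)
  case (Suc m)
  let ?d = "gauss_weight r (int m) - gauss_weight r (int (Suc m))"
  have "gauss_weight r (int (Suc m)) \<le> gauss_weight r (int m)"
    using r by (simp add: gauss_weight_normal normal_density_antimono)
  then have d: "?d\<^sup>2 \<le> 3 / 2 * gauss_weight r 0 / r * ?d"
    unfolding power2_eq_square by (intro mult_right_mono gauss_weight_step[OF r]) auto
  have set: "{1 - int (Suc m)..int (Suc m)} = insert (- int m) (insert (int (Suc m)) {1 - int m..int m})"
    by auto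
  have e: "gauss_weight r (- int m) = gauss_weight r (int m)" "gauss_weight r (- int m - 1) = gauss_weight r (int (Suc m))"
    using gauss_weight_minus[of r "- int m - 1"] by (simp_all add: add.commute)
  have "(\<Sum>l\<in>{1 - int (Suc m)..int (Suc m)}. (gauss_weight r l - gauss_weight r (l - 1))\<^sup>2)
     = (\<Sum>l\<in>{1 - int m..int m}. (gauss_weight r l - gauss_weight r (l - 1))\<^sup>2) + 2 * ?d\<^sup>2"
    unfolding set by (simp add: e power2_commute[of "gauss_weight r (1 + int m)"])
  also have "\<dots> \<le> 3 * gauss_weight r 0 / r * (gauss_weight r 0 - gauss_weight r (int m)) + 2 * (3 / 2 * gauss_weight r 0 / r * ?d)"
    using Suc d by linarith
  also have "\<dots> = 3 * gauss_weight r 0 / r * (gauss_weight r 0 - gauss_weight r (int (Suc m)))"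
    using r by (simp add: field_simps)
  finally show ?case .
qed simp

text \<open>By Parseval the mean square of \<open>S\<close> is the sum of the squared weights, at
  most the largest weight \<open>1 / (2 * r)\<close> times the total mass. That mass is at most 4,
  crudely, from \<open>1 + 1 / (2 * r) + 2 * ?q\<close>.\<close>

lemma expsum_l2:
  assumes r: "1 \<le> r" and L: "0 \<le> L" and N: "0 < N" "2 * L < int N"
  shows "(\<Sum>a<N. (cmod (expsum r L (real a / real N)))\<^sup>2) \<le> real N * (2 / r)"
proof -
  let ?q = "exp (- ((real_of_int L)\<^sup>2 / (2 * r\<^sup>2)))"
  have r0: "0 < r" using r by simp
  have "(\<Sum>a<N. (cmod (expsum r L (real a / real N)))\<^sup>2) =
     real N * (\<Sum>l\<in>{-L..L}. (cmod (of_real (gauss_weight r l)))\<^sup>2)"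
    unfolding expsum_def
  proof (rule parseval_mod[OF N(1)])
    fix l l' assume l: "l \<in> {-L..L}" "l' \<in> {-L..L}" and d: "int N dvd l' - l"
    have "\<bar>l' - l\<bar> < int N" using l N(2) by auto
    then show "l = l'" using d by (metis dvd_imp_le_int eq_iff_diff_eq_0 not_le abs_of_nat)
  qed simp
  also have "(\<Sum>l\<in>{-L..L}. (cmod (of_real (gauss_weight r l)))\<^sup>2) \<le> (\<Sum>l\<in>{-L..L}. 1 / (2 * r) * gauss_weight r l)"
  proof (rule sum_mono)
    fix l
    have "gauss_weight r l \<le> gauss_weight r 0"
      using r0 by (simp add: gauss_weight_normal normal_density_antimono)
    then have "gauss_weight r l \<le> 1 / (2 * r)"
      using gauss_weight_zero_le[OF r0] by linarith
    then show "(cmod (of_real (gauss_weight r l)))\<^sup>2 \<le> 1 / (2 * r) * gauss_weight r l"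
      using gauss_weight_pos[OF r0, of l] mult_right_mono[of "gauss_weight r l" "1 / (2 * r)" "gauss_weight r l"]
      by (simp add: power2_eq_square)
  qed
  also have "\<dots> = 1 / (2 * r) * (\<Sum>l\<in>{-L..L}. gauss_weight r l)"
    by (rule sum_distrib_left[symmetric])
  also have "\<dots> \<le> 1 / (2 * r) * 4"
  proof (rule mult_left_mono)
    have "?q \<le> 1" by simp
    moreover have "1 / (2 * r) \<le> 1" using r by simp
    ultimately show "(\<Sum>l\<in>{-L..L}. gauss_weight r l) \<le> 4"
      using gauss_sum_near_one[OF r0 L] by linarith
  qed (use r in simp)
  finally show ?thesis by (simp add: mult_left_mono)
qed

text \<open>Summation by parts: multiplying by \<open>1 - cis (- 2 * pi * \<theta>)\<close>
  differences the coefficients. Extending the weights by 0 in \<open>g\<close> makes the two cutoffs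
  appear as jumps at \<open>-L\<close> and at \<open>L + 1\<close>.\<close>

lemma expsum_difference:
  fixes \<theta> :: real
  assumes r: "0 < r" and L: "0 \<le> L"
  defines "g \<equiv> \<lambda>l. if \<bar>l\<bar> \<le> L then gauss_weight r l else 0"
  shows "expsum r L \<theta> * (1 - cis (- 2 * pi * \<theta>)) =
    (\<Sum>l\<in>{-L..L+1}. of_real (g l - g (l - 1)) * cis (- 2 * pi * (real_of_int l * \<theta>)))"
proof -
  let ?e = "\<lambda>l. cis (- 2 * pi * (real_of_int l * \<theta>))"
  have e1: "?e l * cis (- 2 * pi * \<theta>) = ?e (l + 1)" for l
    unfolding cis_mult by (rule arg_cong[where f = cis]) (simp add: algebra_simps)
  have S1: "expsum r L \<theta> = (\<Sum>l\<in>{-L..L+1}. of_real (g l) * ?e l)"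
  proof -
    have "{-L..L+1} = insert (L + 1) {-L..L}" using L by auto
    then show ?thesis
      unfolding expsum_def using L by (simp add: g_def abs_le_iff)
  qed
  have "expsum r L \<theta> * cis (- 2 * pi * \<theta>) = (\<Sum>l\<in>{-L..L}. of_real (g l) * ?e (l + 1))"
    unfolding expsum_def sum_distrib_right
  proof (rule sum.cong[OF refl])
    fix l assume "l \<in> {-L..L}"
    then have "gauss_weight r l = g l" by (auto simp: g_def)
    then show "of_real (gauss_weight r l) * ?e l * cis (- 2 * pi * \<theta>) = of_real (g l) * ?e (l + 1)"
      unfolding e1[symmetric] by (simp only: mult.assoc)
  qed
  also have "\<dots> = (\<Sum>l\<in>{-L+1..L+1}. of_real (g (l - 1)) * ?e l)"
    by (rule sum.reindex_bij_witness[where i = "\<lambda>l. l - 1" and j = "\<lambda>l. l + 1"]) auto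
  also have "\<dots> = (\<Sum>l\<in>{-L..L+1}. of_real (g (l - 1)) * ?e l)"
  proof -
    have "{-L..L+1} = insert (- L) {-L+1..L+1}" using L by auto
    then show ?thesis using L by (simp add: g_def)
  qed
  finally show ?thesis
    unfolding right_diff_distrib mult_1_right S1[symmetric]
    using S1 by (simp add: sum_subtractf left_diff_distrib)
qed

lemma expsum_difference_l2:
  assumes r: "1 \<le> r" and L: "2 \<le> L" and N: "3 * L \<le> int N"
    and q: "(exp (- ((real_of_int L)\<^sup>2 / (2 * r\<^sup>2))))\<^sup>2 \<le> 5 / r"
  shows "(\<Sum>a<N. (cmod (expsum r L (real a / real N)))\<^sup>2 * (r\<^sup>2 * (cmod (1 - cis (2 * pi * (real a / real N))))\<^sup>2)) \<le> real N * (4 / r)"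
proof -
  let ?q = "exp (- ((real_of_int L)\<^sup>2 / (2 * r\<^sup>2)))"
  let ?G0 = "gauss_weight r 0"
  define g where "g = (\<lambda>l. if \<bar>l\<bar> \<le> L then gauss_weight r l else 0)"
  have r0: "0 < r" using r by simp
  have L0: "0 \<le> L" and N0: "0 < N" using L N by auto
  have G0: "0 < ?G0" "?G0 \<le> 1 / (2 * r)"
    using gauss_weight_pos[OF r0] gauss_weight_zero_le[OF r0] by auto
  have conj: "cmod (1 - cis (2 * pi * \<theta>)) = cmod (1 - cis (- 2 * pi * \<theta>))" for \<theta>
    using complex_mod_cnj[of "1 - cis (2 * pi * \<theta>)"] by (simp add: cis_cnj)
  have "(\<Sum>a<N. (cmod (expsum r L (real a / real N)))\<^sup>2 * (r\<^sup>2 * (cmod (1 - cis (2 * pi * (real a / real N))))\<^sup>2))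
     = r\<^sup>2 * (\<Sum>a<N. (cmod (expsum r L (real a / real N) * (1 - cis (- 2 * pi * (real a / real N)))))\<^sup>2)"
    unfolding sum_distrib_left norm_mult power_mult_distrib conj
    by (intro sum.cong refl) (rule mult.left_commute)
  also have "(\<Sum>a<N. (cmod (expsum r L (real a / real N) * (1 - cis (- 2 * pi * (real a / real N)))))\<^sup>2)
     = real N * (\<Sum>l\<in>{-L..L+1}. (cmod (of_real (g l - g (l - 1))))\<^sup>2)"
    unfolding expsum_difference[OF r0 L0] g_def
  proof (rule parseval_mod[OF N0])
    fix l l' assume l: "l \<in> {-L..L+1}" "l' \<in> {-L..L+1}" and d: "int N dvd l' - l"
    \<comment> \<open>The range has grown by one index, so differences reach
      \<open>2 * L + 1\<close>; this is below \<open>3 * L \<le> N\<close> because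
      \<open>L \<ge> 2\<close>.\<close>
    have "\<bar>l' - l\<bar> < int N" using l N L by auto
    then show "l = l'" using d by (metis dvd_imp_le_int eq_iff_diff_eq_0 not_le abs_of_nat)
  qed simp
  also have "(\<Sum>l\<in>{-L..L+1}. (cmod (of_real (g l - g (l - 1))))\<^sup>2) =
     2 * (gauss_weight r L)\<^sup>2 + (\<Sum>l\<in>{1-L..L}. (gauss_weight r l - gauss_weight r (l - 1))\<^sup>2)"
  proof -
    have "{-L..L+1} = insert (- L) (insert (L + 1) {1-L..L})" using L by auto
    moreover have "(\<Sum>l\<in>{1-L..L}. (g l - g (l - 1))\<^sup>2) = (\<Sum>l\<in>{1-L..L}. (gauss_weight r l - gauss_weight r (l - 1))\<^sup>2)"
      by (rule sum.cong) (auto simp: g_def)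
    moreover have "g (- L) = gauss_weight r L" "g (- L - 1) = 0" "g (L + 1) = 0" "g L = gauss_weight r L"
      using L by (auto simp: g_def)
    ultimately show ?thesis using L by (simp del: of_real_diff)
  qed
  \<comment> \<open>Jumps and interior steps both contribute at order \<open>r^(-3)\<close>: a
    squared jump is \<open>?G0\<^sup>2 * ?q\<^sup>2\<close> with
    \<open>?G0 \<le> 1 / (2 * r)\<close> and \<open>?q\<^sup>2 \<le> 5 / r\<close>. Together they
    give \<open>10/4 + 3/4 = 13/4\<close>, and the factor \<open>r\<^sup>2\<close> then leaves less
    than \<open>4 / r\<close>.\<close>
  also have "\<dots> \<le> 2 * (1 / (4 * r\<^sup>2) * (5 / r)) + 3 / (4 * r ^ 3)"
  proof (intro add_mono mult_left_mono)
    have "(gauss_weight r L)\<^sup>2 = ?G0\<^sup>2 * ?q\<^sup>2"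
      by (simp add: gauss_weight_def power_mult_distrib power_divide)
    also have "\<dots> \<le> (1 / (2 * r))\<^sup>2 * (5 / r)"
      using G0 q by (intro mult_mono power_mono) auto
    finally show "(gauss_weight r L)\<^sup>2 \<le> 1 / (4 * r\<^sup>2) * (5 / r)"
      by (simp add: power_divide power_mult_distrib)
    have "(\<Sum>l\<in>{1-L..L}. (gauss_weight r l - gauss_weight r (l - 1))\<^sup>2) \<le> 3 * ?G0 / r * (?G0 - gauss_weight r L)"
      using sum_gauss_step_squares[OF r, of "nat L"] L by simp
    also have "\<dots> \<le> 3 * (1 / (2 * r)) / r * (1 / (2 * r))"
      using G0 gauss_weight_pos[OF r0, of L] r0
      by (intro mult_mono divide_right_mono) (auto intro!: divide_nonneg_pos
        simp: gauss_weight_normal[OF r0] normal_density_antimono)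
    also have "\<dots> = 3 / (4 * r ^ 3)"
      by (simp add: power3_eq_cube)
    finally show "(\<Sum>l\<in>{1-L..L}. (gauss_weight r l - gauss_weight r (l - 1))\<^sup>2) \<le> 3 / (4 * r ^ 3)" .
  qed simp
  also have "r\<^sup>2 * (real N * (2 * (1 / (4 * r\<^sup>2) * (5 / r)) + 3 / (4 * r ^ 3))) = real N * (13 / 4 / r)"
    using r0 by (simp add: field_simps power2_eq_square power3_eq_cube)
  also have "\<dots> \<le> real N * (4 / r)"
    using r0 by (intro mult_left_mono divide_right_mono) auto
  finally show ?thesis
    by (simp add: mult_left_mono)
qed

text \<open>
  AM-GM with the weight \<open>W = 1 + r\<^sup>2 |1 - e(a/N)|\<^sup>2\<close>: it grows away from \<open>0\<close> so fast that \<open>\<Sum> 1/W = O(N/r)\<close>,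
  while \<open>\<Sum> |S|\<^sup>2 W\<close> is controlled by Parseval for the weights and for their differences.
\<close>

lemma expsum_average:
  assumes r: "1 \<le> r" "r \<le> real_of_int L" and L: "2 \<le> L" and N: "3 * L \<le> int N"
    and q: "(exp (- ((real_of_int L)\<^sup>2 / (2 * r\<^sup>2))))\<^sup>2 \<le> 5 / r"
  shows "(\<Sum>a<N. cmod (expsum r L (real a / real N))) \<le> 5 * real N / r"
proof -
  let ?W = "\<lambda>a. 1 + r\<^sup>2 * (cmod (1 - cis (2 * pi * (real a / real N))))\<^sup>2"
  let ?S = "\<lambda>a. cmod (expsum r L (real a / real N))"
  have N0: "0 < N" and NL: "2 * L < int N" and L0: "0 \<le> L" using L N by auto
  have r0: "0 < r" using r by simp
  have "real_of_int (3 * L) \<le> real_of_int (int N)" using N of_int_le_iff by blast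
  then have rN: "3 * r \<le> real N" using r(2) by simp
  have "2 * ?S a \<le> (?S a)\<^sup>2 * ?W a + 1 / ?W a" for a
  proof -
    have W: "0 < ?W a" by (intro add_pos_nonneg) auto
    have "0 \<le> (?S a * ?W a - 1)\<^sup>2 / ?W a" using W by simp
    also have "\<dots> = (?S a)\<^sup>2 * ?W a + 1 / ?W a - 2 * ?S a"
      using W by (simp add: power2_eq_square field_simps)
    finally show ?thesis by simp
  qed
  then have "2 * (\<Sum>a<N. ?S a) \<le> (\<Sum>a<N. (?S a)\<^sup>2 * ?W a + 1 / ?W a)"
    unfolding sum_distrib_left by (intro sum_mono)
  also have "\<dots> = (\<Sum>a<N. (?S a)\<^sup>2) + (\<Sum>a<N. (?S a)\<^sup>2 * (r\<^sup>2 * (cmod (1 - cis (2 * pi * (real a / real N))))\<^sup>2)) + (\<Sum>a<N. 1 / ?W a)"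
    by (simp only: distrib_left sum.distrib mult_1_right)
  also have "\<dots> \<le> real N * (2 / r) + real N * (4 / r) + 3 * real N / r"
    using expsum_l2[OF r(1) L0 N0 NL] expsum_difference_l2[OF r(1) L N q] sum_inverse_weight_le[OF r0 N0 rN]
    by linarith
  also have "\<dots> = 9 * real N / r"
    by (simp add: field_simps)
  finally have "2 * (\<Sum>a<N. ?S a) \<le> 9 * real N / r" .
  moreover have "0 \<le> real N / r" using r0 by simp
  ultimately show ?thesis by (simp add: field_simps)
qed

section \<open>The error of the randomized lattice rule\<close>

text \<open>With all coordinates of \<open>H\<close> other than \<open>j\<close> fixed,
  \<open>k j\<close> is invertible modulo the prime \<open>N\<close>, so \<open>H j\<close> runs
  injectively through the residues. It takes \<open>N - 1\<close> values and misses one residue;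
  nonnegativity of \<open>F\<close> allows filling the gap, at the cost of an inequality.\<close>

lemma frequency_residue_sum:
  fixes k :: "nat \<Rightarrow> int" and F :: "int \<Rightarrow> real"
  assumes N: "prime N" and j: "j < d" and kj: "0 < \<bar>k j\<bar>" "\<bar>k j\<bar> < int N"
    and F: "\<And>a. 0 \<le> F a"
  shows "(\<Sum>H\<in>(\<Pi>\<^sub>E j\<in>{..<d}. {1..<int N}). F ((\<Sum>i<d. k i * H i) mod int N))
     \<le> real (N - 1) ^ (d - 1) * (\<Sum>a<N. F (int a))"
proof -
  let ?I = "{..<d} - {j}"
  let ?B = "{1..<int N}"
  have N0: "0 < N" using N prime_gt_0_nat by blast
  have "prime (int N)" using N by simp
  then have cop: "coprime (k j) (int N)"
    using kj by (metis abs_of_pos coprime_commute dvd_imp_le_int not_le of_nat_0_le_iff abs_of_nonneg prime_imp_coprime zero_less_abs_iff)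
  have inner: "(\<Sum>h\<in>?B. F ((k j * h + c) mod int N)) \<le> (\<Sum>a<N. F (int a))" for c
  proof -
    have inj: "inj_on (\<lambda>h. (k j * h + c) mod int N) ?B"
    proof (rule inj_onI)
      fix h h' assume h: "h \<in> ?B" "h' \<in> ?B" and "(k j * h + c) mod int N = (k j * h' + c) mod int N"
      then have "int N dvd k j * h - k j * h'"
        by (simp add: mod_eq_dvd_iff)
      then have "int N dvd h - h'"
        using cop by (metis coprime_commute coprime_dvd_mult_right_iff right_diff_distrib)
      moreover have "\<bar>h - h'\<bar> < int N" using h by auto
      ultimately show "h = h'"
        by (metis dvd_imp_le_int eq_iff_diff_eq_0 not_le abs_of_nat)
    qed
    have "(\<Sum>h\<in>?B. F ((k j * h + c) mod int N)) = (\<Sum>a\<in>(\<lambda>h. (k j * h + c) mod int N) ` ?B. F a)"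
      by (simp add: sum.reindex[OF inj])
    also have "\<dots> \<le> (\<Sum>a\<in>int ` {..<N}. F a)"
    proof (rule sum_mono2)
      show "(\<lambda>h. (k j * h + c) mod int N) ` ?B \<subseteq> int ` {..<N}"
      proof
        fix y assume "y \<in> (\<lambda>h. (k j * h + c) mod int N) ` ?B"
        then have "0 \<le> y" "y < int N" using N0 by auto
        then show "y \<in> int ` {..<N}" by (intro image_eqI[of _ _ "nat y"]) auto
      qed
    qed (auto simp: F)
    also have "\<dots> = (\<Sum>a<N. F (int a))"
      by (simp add: sum.reindex)
    finally show ?thesis .
  qed
  have ins: "{..<d} = insert j ?I" using j by auto
  have "(\<Sum>H\<in>(\<Pi>\<^sub>E j\<in>{..<d}. ?B). F ((\<Sum>i<d. k i * H i) mod int N)) =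
     (\<Sum>(h, H)\<in>?B \<times> (\<Pi>\<^sub>E j\<in>?I. ?B). F ((\<Sum>i<d. k i * (H(j := h)) i) mod int N))"
  proof -
    have img: "(\<Pi>\<^sub>E j\<in>{..<d}. ?B) = (\<lambda>(h, H). H(j := h)) ` (?B \<times> (\<Pi>\<^sub>E j\<in>?I. ?B))"
      by (subst ins) (rule PiE_insert_eq)
    have inj: "inj_on (\<lambda>(h, H). H(j := h)) (?B \<times> (\<Pi>\<^sub>E j\<in>?I. ?B))"
      by (rule inj_combinator) simp
    show ?thesis
      unfolding img sum.reindex[OF inj] by (simp add: o_def case_prod_beta del: fun_upd_apply)
  qed
  also have "\<dots> = (\<Sum>H\<in>(\<Pi>\<^sub>E j\<in>?I. ?B). \<Sum>h\<in>?B. F ((\<Sum>i<d. k i * (H(j := h)) i) mod int N))"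
    by (simp add: sum.cartesian_product[symmetric] sum.swap[of _ _ ?B])
  also have "\<dots> \<le> (\<Sum>H\<in>(\<Pi>\<^sub>E j\<in>?I. ?B). \<Sum>a<N. F (int a))"
  proof (rule sum_mono)
    fix H
    have "(\<Sum>i<d. k i * (H(j := h)) i) = k j * h + (\<Sum>i\<in>?I. k i * H i)" for h
      using j by (subst sum.remove[of _ j]) auto
    then show "(\<Sum>h\<in>?B. F ((\<Sum>i<d. k i * (H(j := h)) i) mod int N)) \<le> (\<Sum>a<N. F (int a))"
      using inner by simp
  qed
  also have "\<dots> = real (card (\<Pi>\<^sub>E j\<in>?I. ?B)) * (\<Sum>a<N. F (int a))"
    by simp
  also have "card (\<Pi>\<^sub>E j\<in>?I. ?B) = (N - 1) ^ (d - 1)"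
    using j N0 by (subst card_PiE) (auto simp: nat_diff_distrib)
  finally show ?thesis by simp
qed

definition dotN :: "nat \<Rightarrow> nat \<Rightarrow> (nat \<Rightarrow> int) \<Rightarrow> (nat \<Rightarrow> int) \<Rightarrow> real" where
  "dotN d N k H = real_of_int (\<Sum>i<d. k i * H i) / real N"

lemma expsum_mod:
  assumes "0 < N"
  shows "expsum r L (real_of_int (m mod int N) / real N) = expsum r L (real_of_int m / real N)"
proof -
  have "real_of_int m = real_of_int (m mod int N) + real N * real_of_int (m div int N)"
    by (metis mod_mult_div_eq of_int_add of_int_mult of_int_of_nat_eq)
  then have e: "real_of_int m / real N = real_of_int (m mod int N) / real N + real_of_int (m div int N)"
    using assms by (simp add: field_simps)
  have "cis (- 2 * pi * (real_of_int l * (x + real_of_int n))) = cis (- 2 * pi * (real_of_int l * x))" for l n x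
  proof -
    have "cis (- 2 * pi * (real_of_int l * (x + real_of_int n))) =
      cis (- 2 * pi * (real_of_int l * x)) * cis (2 * pi * real_of_int (- l * n))"
      unfolding cis_mult by (rule arg_cong[where f = cis]) (simp add: algebra_simps)
    also have "cis (2 * pi * real_of_int (- l * n)) = 1"
      by (rule cis_multiple_2pi) simp
    finally show ?thesis by simp
  qed
  then show ?thesis
    unfolding expsum_def e by simp
qed

lemma finite_set_Hz_pmf:
  assumes "2 \<le> N"
  shows "finite (set_pmf (Hz_pmf d N))"
  using assms unfolding Hz_pmf_def
  by (simp add: set_pair_pmf PiE_eq_empty_iff finite_PiE)

lemma expectation_expsum:
  assumes N: "prime N" and j: "j < d" and kj: "0 < \<bar>k j\<bar>" "\<bar>k j\<bar> < int N"
    and avg: "(\<Sum>a<N. cmod (expsum r L (real a / real N))) \<le> 5 * real N / r" and r: "0 < r"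
  shows "measure_pmf.expectation (Hz_pmf d N) (\<lambda>\<omega>. cmod (expsum r L (dotN d N k (fst \<omega>)))) \<le> 10 / r"
proof -
  let ?X = "\<Pi>\<^sub>E j\<in>{..<d}. {1..<int N}"
  have N2: "2 \<le> N" using N prime_ge_2_nat by blast
  have X: "?X \<noteq> {}" "finite ?X" using N2 by (auto simp: PiE_eq_empty_iff intro!: finite_PiE)
  have card: "card ?X = (N - 1) ^ d"
    using N2 by (subst card_PiE) (auto simp: nat_diff_distrib)
  let ?F = "\<lambda>m::int. cmod (expsum r L (real_of_int m / real N))"
  have "measure_pmf.expectation (Hz_pmf d N) (\<lambda>\<omega>. cmod (expsum r L (dotN d N k (fst \<omega>)))) =
     measure_pmf.expectation (map_pmf fst (Hz_pmf d N)) (\<lambda>H. cmod (expsum r L (dotN d N k H)))"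
    by simp
  also have "\<dots> = (\<Sum>H\<in>?X. cmod (expsum r L (dotN d N k H))) / real ((N - 1) ^ d)"
    unfolding Hz_pmf_def map_fst_pair_pmf integral_pmf_of_set[OF X] card by simp
  also have "(\<Sum>H\<in>?X. cmod (expsum r L (dotN d N k H))) = (\<Sum>H\<in>?X. ?F ((\<Sum>i<d. k i * H i) mod int N))"
    using N2 by (intro sum.cong refl) (simp add: dotN_def expsum_mod)
  also have "\<dots> \<le> real (N - 1) ^ (d - 1) * (\<Sum>a<N. ?F (int a))"
    by (rule frequency_residue_sum[where k = k and F = ?F, OF N j kj]) simp
  also have "\<dots> \<le> real (N - 1) ^ (d - 1) * (5 * real N / r)"
    using avg by (intro mult_left_mono) auto
  also have "\<dots> / real ((N - 1) ^ d) = 5 * (real N / real (N - 1)) / r"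
  proof -
    have "real ((N - 1) ^ d) = real (N - 1) ^ (d - 1) * real (N - 1)"
      using j by (cases d) auto
    moreover have "p ^ (d - 1) * (5 * real N / r) / (p ^ (d - 1) * p) = 5 * (real N / p) / r" if "0 < p" for p :: real
      using that by simp
    ultimately show ?thesis using N2 by (simp only:)
  qed
  \<comment> \<open>A sum over \<open>N\<close> residues is averaged over \<open>N - 1\<close>
    values of \<open>H j\<close>; the ratio is at most 2 and turns 5 into 10.\<close>
  also have "\<dots> \<le> 5 * 2 / r"
    using N2 r by (intro divide_right_mono mult_left_mono) (auto simp: field_simps)
  finally show ?thesis using N2 by (simp add: divide_right_mono)
qed

section \<open>Fourier expansion of the quadrature error\<close>

lemma has_sum_finite_sum:
  fixes f :: "'i \<Rightarrow> 'a \<Rightarrow> 'b::topological_comm_monoid_add"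
  assumes "finite I" "\<And>i. i \<in> I \<Longrightarrow> (f i has_sum s i) A"
  shows "((\<lambda>k. \<Sum>i\<in>I. f i k) has_sum (\<Sum>i\<in>I. s i)) A"
  using assms by (induction I rule: finite_induct) (auto intro!: has_sum_add has_sum_0)

text \<open>The integer parts removed by \<open>frac\<close> are multiplied by the integers
  \<open>k j\<close> and vanish in the character. The rest separates into a phase from
  \<open>z\<close>, common to all nodes, and the oscillating factor of \<open>expsum\<close> at
  \<open>dotN d N k H\<close>.\<close>

lemma chr_node:
  "chr d k (\<lambda>j\<in>{..<d}. frac (real_of_int (z j - l * H j) / real N)) =
     cis (2 * pi * dotN d N k z) * cis (- 2 * pi * (real_of_int l * dotN d N k H))"
proof -
  let ?t = "\<lambda>j. real_of_int (z j - l * H j) / real N"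
  have fr: "real_of_int (k j) * frac (?t j) = real_of_int (k j) * ?t j - real_of_int (k j * \<lfloor>?t j\<rfloor>)" for j
    by (simp add: frac_def algebra_simps)
  have "(\<Sum>j<d. real_of_int (k j) * (\<lambda>j\<in>{..<d}. frac (?t j)) j) =
      (\<Sum>j<d. real_of_int (k j) * ?t j) - real_of_int (\<Sum>j<d. k j * \<lfloor>?t j\<rfloor>)"
    unfolding of_int_sum sum_subtractf[symmetric] fr[symmetric] by (intro sum.cong refl) simp
  also have "(\<Sum>j<d. real_of_int (k j) * ?t j) = dotN d N k z - real_of_int l * dotN d N k H"
    unfolding dotN_def of_int_sum sum_divide_distrib sum_distrib_left sum_subtractf[symmetric]
    by (intro sum.cong refl) (simp add: algebra_simps diff_divide_distrib)
  finally have s: "(\<Sum>j<d. real_of_int (k j) * (\<lambda>j\<in>{..<d}. frac (?t j)) j) =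
      dotN d N k z - real_of_int l * dotN d N k H - real_of_int (\<Sum>j<d. k j * \<lfloor>?t j\<rfloor>)" .
  have split: "cis (2 * pi * (a - real_of_int l * b - real_of_int n)) =
      cis (2 * pi * a) * cis (- 2 * pi * (real_of_int l * b)) * cis (2 * pi * real_of_int (- n))" for a b n
    unfolding cis_mult by (rule arg_cong[where f = cis]) (simp add: algebra_simps)
  have "chr d k (\<lambda>j\<in>{..<d}. frac (?t j)) = cis (2 * pi * dotN d N k z)
      * cis (- 2 * pi * (real_of_int l * dotN d N k H)) * cis (2 * pi * real_of_int (- (\<Sum>j<d. k j * \<lfloor>?t j\<rfloor>)))"
    unfolding chr_def s by (rule split)
  also have "cis (2 * pi * real_of_int (- (\<Sum>j<d. k j * \<lfloor>?t j\<rfloor>))) = 1"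
    by (rule cis_multiple_2pi) (rule Ints_of_int)
  finally show ?thesis by (simp only: mult_1_right)
qed

lemma quad_expansion:
  assumes f: "continuous_torus d f"
    and summable: "(\<lambda>k. cmod (fourier_coeff d f k)) summable_on ZVec d"
  shows "((\<lambda>k. fourier_coeff d f k * (cis (2 * pi * dotN d N k z) * expsum r L (dotN d N k H)))
     has_sum quad d f N L r (H, z)) (ZVec d)"
proof -
  let ?y = "\<lambda>l. \<lambda>j\<in>{..<d}. frac (real_of_int (z j - l * H j) / real N)"
  have "((\<lambda>k. fourier_coeff d f k * chr d k (?y l)) has_sum f (?y l)) (ZVec d)" for l
  proof -
    have "?y l \<in> unit_cube d"
      by (auto simp: unit_cube_def intro!: frac_ge_0 less_imp_le[OF frac_lt_1])
    then have "f (?y l) = (\<Sum>\<^sub>\<infinity>k\<in>ZVec d. fourier_coeff d f k * chr d k (?y l))"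
      by (rule fourier_inversion[OF f summable])
    moreover have "(\<lambda>k. fourier_coeff d f k * chr d k (?y l)) summable_on ZVec d"
      by (rule abs_summable_summable) (use summable in \<open>simp add: norm_mult\<close>)
    ultimately show ?thesis by (simp add: has_sum_infsum)
  qed
  then have "((\<lambda>k. \<Sum>l\<in>{-L..L}. fourier_coeff d f k * chr d k (?y l) * of_real (gauss_weight r l))
     has_sum (\<Sum>l\<in>{-L..L}. f (?y l) * of_real (gauss_weight r l))) (ZVec d)"
    by (intro has_sum_finite_sum has_sum_cmult_left) auto
  moreover have "(\<Sum>l\<in>{-L..L}. fourier_coeff d f k * chr d k (?y l) * of_real (gauss_weight r l)) =
     fourier_coeff d f k * (cis (2 * pi * dotN d N k z) * expsum r L (dotN d N k H))" for k
    unfolding chr_node expsum_def sum_distrib_left by (intro sum.cong refl) (simp only: mult_ac)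
  ultimately show ?thesis by (simp add: quad_def)
qed

lemma fourier_coeff_zero: "fourier_coeff d f (zero_vec d) = INT_f d f"
  unfolding fourier_coeff_chr by (simp add: chr_def zero_vec_def INT_f_def)

text \<open>The minimizing coordinate has two uses: it determines the weight \<kappa>, and when the
  minimum is below \<open>N\<close> it is the invertible coordinate that
  \<open>frequency_residue_sum\<close> asks for.\<close>

lemma min_supp:
  assumes "k \<in> ZVec d - {zero_vec d}"
  obtains j where "j < d" "0 < \<bar>k j\<bar>" "Min ((\<lambda>j. \<bar>k j\<bar>) ` supp d k) = \<bar>k j\<bar>"
proof -
  have "supp d k \<noteq> {}"
  proof
    assume "supp d k = {}"
    then have "k = zero_vec d"
      using assms by (intro ext) (auto simp: supp_def zero_vec_def ZVec_def PiE_def extensional_def)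
    then show False using assms by simp
  qed
  then have "Min ((\<lambda>j. \<bar>k j\<bar>) ` supp d k) \<in> (\<lambda>j. \<bar>k j\<bar>) ` supp d k"
    by (intro Min_in) (auto simp: supp_def)
  then show ?thesis using that by (auto simp: supp_def)
qed

lemma A_term_ge:
  assumes "k \<in> ZVec d - {zero_vec d}" "\<And>x. 0 < x \<Longrightarrow> 1 \<le> \<kappa> x"
  shows "cmod (fourier_coeff d f k) \<le> A_term d \<kappa> f k"
proof -
  obtain j where "0 < \<bar>k j\<bar>" "Min ((\<lambda>j. \<bar>k j\<bar>) ` supp d k) = \<bar>k j\<bar>"
    using min_supp[OF assms(1)] by blast
  then have "1 \<le> \<kappa> (real_of_int (Min ((\<lambda>j. \<bar>k j\<bar>) ` supp d k)))"
    using assms(2) by auto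
  then show ?thesis
    unfolding A_term_def norm_mult norm_of_real
    using mult_left_mono[of 1 "\<bar>\<kappa> (real_of_int (Min ((\<lambda>j. \<bar>k j\<bar>) ` supp d k)))\<bar>" "cmod (fourier_coeff d f k)"]
    by simp
qed

text \<open>The bound is deterministic and holds for every \<omega>, so it can later be applied to
  each copy separately; chance enters only through the expectation of \<open>X\<close>. In
  \<open>6 * \<epsilon>\<close>, 2 comes from the Gaussian tails at frequency 0 and 4 from the
  frequencies outside \<open>K\<close>.\<close>

lemma quadrature_error:
  assumes \<kappa>1: "\<And>x. 0 < x \<Longrightarrow> 1 \<le> \<kappa> x" and \<kappa>: "mono_on {0<..} \<kappa>"
    and \<kappa>N: "1 / \<epsilon> \<le> \<kappa> (real N)" and \<epsilon>: "0 < \<epsilon>"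
    and f: "f \<in> A_space d \<kappa>" "A_norm d \<kappa> f \<le> 1"
    and N: "prime N" "3 * L \<le> int N"
    and r: "1 \<le> r" "r \<le> real_of_int L" and L: "2 \<le> L"
    and q: "exp (- ((real_of_int L)\<^sup>2 / (2 * r\<^sup>2))) \<le> \<epsilon>"
    and q2: "(exp (- ((real_of_int L)\<^sup>2 / (2 * r\<^sup>2))))\<^sup>2 \<le> 5 / r"
  obtains X where "\<And>\<omega>. 0 \<le> X \<omega>"
    "\<And>\<omega>. cmod (quad d f N L r \<omega> - INT_f d f) \<le> 1 / (2 * r) + 6 * \<epsilon> + X \<omega>"
    "measure_pmf.expectation (Hz_pmf d N) X \<le> 10 / r"
proof -
  let ?q = "exp (- ((real_of_int L)\<^sup>2 / (2 * r\<^sup>2)))"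
  let ?c = "fourier_coeff d f" and ?A = "A_term d \<kappa> f"
  let ?Z = "ZVec d - {zero_vec d}"
  let ?S = "expsum r L"
  let ?min = "\<lambda>k. Min ((\<lambda>j. \<bar>k j\<bar>) ` supp d k)"
  \<comment> \<open>The frequencies with a nonzero entry below \<open>N\<close> in absolute value.
    Outside \<open>K\<close> monotonicity gives \<kappa> at least \<open>1 / \<epsilon>\<close>, so
    the coefficient is at most \<epsilon> times its term in the norm.\<close>
  define K where "K = {k \<in> ?Z. ?min k < int N}"
  have r0: "0 < r" using r by simp
  have N2: "2 \<le> N" using N(1) prime_ge_2_nat by blast
  have ft: "continuous_torus d f" and sA: "?A summable_on ?Z"
    using f(1) by (auto simp: A_space_def)
  have A0: "0 \<le> ?A k" for k by (simp add: A_term_def)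
  have cA: "cmod (?c k) \<le> ?A k" if "k \<in> ?Z" for k
    using A_term_ge[OF that \<kappa>1] .
  have A1: "cmod (?c (zero_vec d)) \<le> 1" "infsum ?A ?Z \<le> 1"
    using f(2) infsum_nonneg[of ?Z ?A, OF A0] norm_ge_zero[of "?c (zero_vec d)"]
    unfolding A_norm_def by (smt (verit))+
  have sc: "(\<lambda>k. cmod (?c k)) summable_on ?Z"
    by (rule summable_on_comparison_test[OF sA]) (use cA in auto)
  have Zins: "ZVec d = insert (zero_vec d) ?Z"
    by (auto simp: ZVec_def zero_vec_def split: if_splits)
  have sZ: "(\<lambda>k. cmod (?c k)) summable_on ZVec d"
    using sc by (subst Zins, subst summable_on_insert_iff)
  have S1: "\<bar>(\<Sum>l\<in>{-L..L}. gauss_weight r l) - 1\<bar> \<le> 1 / (2 * r) + 2 * ?q"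
    using gauss_sum_near_one[OF r0] L by simp
  \<comment> \<open>The trivial bound by the total mass; outside \<open>K\<close> the factor
    \<epsilon> already comes from the coefficients.\<close>
  have S4: "cmod (?S \<theta>) \<le> 4" for \<theta>
  proof -
    have "cmod (?S \<theta>) \<le> (\<Sum>l\<in>{-L..L}. cmod (of_real (gauss_weight r l) * cis (- 2 * pi * (real_of_int l * \<theta>))))"
      unfolding expsum_def by (rule norm_sum)
    also have "\<dots> = (\<Sum>l\<in>{-L..L}. gauss_weight r l)"
      using gauss_weight_pos[OF r0] by (simp add: norm_mult less_imp_le)
    also have "\<dots> \<le> 4"
    proof -
      have "?q \<le> 1" by simp
      moreover have "1 / (2 * r) \<le> 1" using r by simp
      ultimately show ?thesis using S1 by linarith
    qed
    finally show ?thesis .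
  qed
  define t where "t = (\<lambda>k H. cmod (?c k) * cmod (?S (dotN d N k H)))"
  have t0: "0 \<le> t k H" for k H by (simp add: t_def)
  have st: "(\<lambda>k. t k H) summable_on ?Z" for H
    by (rule summable_on_comparison_test[OF summable_on_cmult_left[OF sc, of 4]])
       (auto simp: t_def intro!: mult_left_mono S4)
  have stK: "(\<lambda>k. t k H) summable_on K" for H
    by (rule summable_on_subset_banach[OF st]) (auto simp: K_def)
  \<comment> \<open>Absolute values are taken frequency by frequency, so the phases disappear and
    \<open>X\<close> depends on \<open>H\<close> only. Its expectation is then linear in the
    \<open>|c(k)|\<close> and needs no information on the joint behaviour of different
    frequencies.\<close>
  define X where "X = (\<lambda>\<omega>::(nat \<Rightarrow> int) \<times> (nat \<Rightarrow> int). infsum (\<lambda>k. t k (fst \<omega>)) K)"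
  have X0: "0 \<le> X \<omega>" for \<omega>
    unfolding X_def by (intro infsum_nonneg t0)
  have high: "t k H \<le> 4 * \<epsilon> * ?A k" if k: "k \<in> ?Z" "k \<notin> K" for k H
  proof -
    obtain j where j: "0 < \<bar>k j\<bar>" "?min k = \<bar>k j\<bar>"
      using min_supp[OF k(1)] by blast
    have "real N \<le> real_of_int (?min k)"
      using k by (auto simp: K_def)
    then have "1 / \<epsilon> \<le> \<kappa> (real_of_int (?min k))"
      using \<kappa>N mono_onD[OF \<kappa>, of "real N" "real_of_int (?min k)"] N2 by force
    then have "cmod (?c k) * (1 / \<epsilon>) \<le> ?A k"
      unfolding A_term_def norm_mult norm_of_real by (intro mult_left_mono) auto
    then have "cmod (?c k) \<le> \<epsilon> * ?A k"
      using \<epsilon> by (simp add: field_simps)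
    then show ?thesis
      unfolding t_def using mult_mono[OF _ S4[of "dotN d N k H"], of "cmod (?c k)" "\<epsilon> * ?A k"] \<epsilon> A0[of k]
      by (simp add: mult_ac)
  qed
  have err: "cmod (quad d f N L r \<omega> - INT_f d f) \<le> 1 / (2 * r) + 6 * \<epsilon> + X \<omega>" for \<omega>
  proof -
    obtain H z where \<omega>: "\<omega> = (H, z)" by (cases \<omega>)
    let ?g = "\<lambda>k. ?c k * (cis (2 * pi * dotN d N k z) * ?S (dotN d N k H))"
    have g: "cmod (?g k) = t k H" for k
      by (simp add: t_def norm_mult)
    have sg: "?g summable_on ?Z"
      by (rule abs_summable_summable) (use st in \<open>simp add: g\<close>)
    have "quad d f N L r \<omega> = infsum ?g (insert (zero_vec d) ?Z)"
      using quad_expansion[OF ft sZ, of N z r L H] unfolding \<omega> Zins[symmetric] by (simp add: infsumI)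
    also have "\<dots> = ?g (zero_vec d) + infsum ?g ?Z"
      by (rule infsum_insert[OF sg]) simp
    finally have Q: "quad d f N L r \<omega> = ?g (zero_vec d) + infsum ?g ?Z" .
    have dot0: "dotN d N (zero_vec d) H = 0" for H
      by (simp add: dotN_def zero_vec_def)
    have "?g (zero_vec d) = INT_f d f * of_real (\<Sum>l\<in>{-L..L}. gauss_weight r l)"
      by (simp add: fourier_coeff_zero dot0 expsum_def)
    then have "?g (zero_vec d) - INT_f d f = INT_f d f * of_real ((\<Sum>l\<in>{-L..L}. gauss_weight r l) - 1)"
      by (simp add: algebra_simps)
    then have "cmod (?g (zero_vec d) - INT_f d f) = cmod (INT_f d f) * \<bar>(\<Sum>l\<in>{-L..L}. gauss_weight r l) - 1\<bar>"
      by (simp only: norm_mult norm_of_real)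
    also have "\<dots> \<le> 1 * (1 / (2 * r) + 2 * \<epsilon>)"
      using A1(1) S1 q by (intro mult_mono) (auto simp: fourier_coeff_zero)
    finally have 1: "cmod (?g (zero_vec d) - INT_f d f) \<le> 1 / (2 * r) + 2 * \<epsilon>" by simp
    have "cmod (infsum ?g ?Z) \<le> infsum (\<lambda>k. t k H) ?Z"
      using norm_infsum_bound[of ?g ?Z] st by (simp add: g)
    also have "infsum (\<lambda>k. t k H) ?Z = infsum (\<lambda>k. t k H) K + infsum (\<lambda>k. t k H) (?Z - K)"
    proof -
      have "K \<union> (?Z - K) = ?Z" by (auto simp: K_def)
      then show ?thesis
        using infsum_Un_disjoint[OF stK[of H] summable_on_subset_banach[OF st[of H]], of "?Z - K"] by auto
    qed
    also have "infsum (\<lambda>k. t k H) (?Z - K) \<le> infsum (\<lambda>k. 4 * \<epsilon> * ?A k) ?Z"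
      using st by (intro infsum_mono_neutral summable_on_cmult_right sA summable_on_subset_banach[OF st])
        (use high \<epsilon> A0 in auto)
    also have "infsum (\<lambda>k. 4 * \<epsilon> * ?A k) ?Z = 4 * \<epsilon> * infsum ?A ?Z"
      by (rule infsum_cmult_right')
    also have "\<dots> \<le> 4 * \<epsilon> * 1"
      using A1(2) \<epsilon> by (intro mult_left_mono) auto
    finally have 2: "cmod (infsum ?g ?Z) \<le> X \<omega> + 4 * \<epsilon>"
      by (simp add: X_def \<omega>)
    have "quad d f N L r \<omega> - INT_f d f = (?g (zero_vec d) - INT_f d f) + infsum ?g ?Z"
      unfolding Q by simp
    then have "cmod (quad d f N L r \<omega> - INT_f d f) \<le> cmod (?g (zero_vec d) - INT_f d f) + cmod (infsum ?g ?Z)"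
      by (simp only: norm_triangle_ineq)
    then show ?thesis using 1 2 by linarith
  qed
  have "measure_pmf.expectation (Hz_pmf d N) X \<le> 10 / r"
  proof -
    let ?P = "Hz_pmf d N"
    have fin: "finite (set_pmf ?P)" by (rule finite_set_Hz_pmf[OF N2])
    have E: "measure_pmf.expectation ?P h = (\<Sum>\<omega>\<in>set_pmf ?P. h \<omega> * pmf ?P \<omega>)" for h :: "_ \<Rightarrow> real"
      by (rule integral_measure_pmf_real[OF fin]) auto
    \<comment> \<open>The law has finite support, so the expectation is a finite sum and commutes
      with the infinite sum over \<open>K\<close>.\<close>
    have "((\<lambda>k. \<Sum>\<omega>\<in>set_pmf ?P. t k (fst \<omega>) * pmf ?P \<omega>) has_sum (\<Sum>\<omega>\<in>set_pmf ?P. X \<omega> * pmf ?P \<omega>)) K"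
      unfolding X_def by (intro has_sum_finite_sum[OF fin] has_sum_cmult_left has_sum_infsum stK)
    then have 1: "((\<lambda>k. measure_pmf.expectation ?P (\<lambda>\<omega>. t k (fst \<omega>))) has_sum measure_pmf.expectation ?P X) K"
      unfolding E .
    have sK: "(\<lambda>k. cmod (?c k)) summable_on K"
      by (rule summable_on_subset_banach[OF sc]) (auto simp: K_def)
    have 2: "((\<lambda>k. cmod (?c k) * (10 / r)) has_sum (infsum (\<lambda>k. cmod (?c k)) K * (10 / r))) K"
      by (intro has_sum_cmult_left has_sum_infsum sK)
    have "measure_pmf.expectation ?P X \<le> infsum (\<lambda>k. cmod (?c k)) K * (10 / r)"
    proof (rule has_sum_mono[OF 1 2])
      fix k assume k: "k \<in> K"
      then obtain j where j: "j < d" "0 < \<bar>k j\<bar>" "?min k = \<bar>k j\<bar>"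
        using min_supp[of k d] by (auto simp: K_def)
      then have kN: "\<bar>k j\<bar> < int N" using k by (auto simp: K_def)
      then have "measure_pmf.expectation ?P (\<lambda>\<omega>. cmod (?S (dotN d N k (fst \<omega>)))) \<le> 10 / r"
        using expectation_expsum[where k = k, OF N(1) j(1) j(2) kN expsum_average[OF r L N(2) q2] r0] by simp
      then show "measure_pmf.expectation ?P (\<lambda>\<omega>. t k (fst \<omega>)) \<le> cmod (?c k) * (10 / r)"
        unfolding t_def integral_mult_right_zero by (rule mult_left_mono) simp
    qed
    also have "\<dots> \<le> 1 * (10 / r)"
    proof (rule mult_right_mono)
      have "infsum (\<lambda>k. cmod (?c k)) K \<le> infsum ?A ?Z"
        by (rule infsum_mono_neutral[OF sK sA]) (use cA A0 in \<open>auto simp: K_def\<close>)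
      then show "infsum (\<lambda>k. cmod (?c k)) K \<le> 1" using A1(2) by linarith
    qed (use r0 in simp)
    finally show ?thesis by simp
  qed
  then show ?thesis using that X0 err by blast
qed

section \<open>Medians of independent copies\<close>

text \<open>In a sorted list of length \<open>2 * m + 1\<close> there are \<open>m + 1\<close>
  entries on either side of the median, itself included. Those on the side away from
  \<open>c\<close> are at least as far from \<open>c\<close> as the median is.\<close>

lemma median_index_set:
  assumes odd: "odd (length xs)"
  obtains J where "J \<subseteq> {..<length xs}" "card J = (length xs + 1) div 2"
    "\<And>j. j \<in> J \<Longrightarrow> \<bar>median xs - c\<bar> \<le> \<bar>xs ! j - c\<bar>"
proof -
  obtain m where m: "length xs = 2 * m + 1" using odd by (auto elim: oddE)
  let ?ys = "sort xs"
  have med: "median xs = ?ys ! m" by (simp add: median_def m)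
  have count: "card {j. j < length xs \<and> P (xs ! j)} = length (filter P ?ys)" for P
    by (simp add: filter_sort length_filter_conv_card)
  have nth_mono: "?ys ! i \<le> ?ys ! j" if "i \<le> j" "j < length xs" for i j
    using that by (simp add: sorted_nth_mono)
  have ge: "m + 1 \<le> card {j. j < length xs \<and> median xs \<le> xs ! j}"
  proof -
    have "card {m..<length xs} \<le> card {j. j < length ?ys \<and> median xs \<le> ?ys ! j}"
      by (intro card_mono) (auto simp: med nth_mono)
    then show ?thesis unfolding count[of "\<lambda>x. median xs \<le> x"] length_filter_conv_card by (simp add: m)
  qed
  have le: "m + 1 \<le> card {j. j < length xs \<and> xs ! j \<le> median xs}"
  proof -
    have "card {..m} \<le> card {j. j < length ?ys \<and> ?ys ! j \<le> median xs}"
      by (intro card_mono) (auto simp: med m nth_mono)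
    then show ?thesis unfolding count[of "\<lambda>x. x \<le> median xs"] length_filter_conv_card by (simp add: m)
  qed
  obtain S where S: "S \<subseteq> {..<length xs}" "m + 1 \<le> card S"
    "\<And>j. j \<in> S \<Longrightarrow> \<bar>median xs - c\<bar> \<le> \<bar>xs ! j - c\<bar>"
  proof (cases "c \<le> median xs")
    case True
    show ?thesis by (rule that[OF _ ge]) (use True in auto)
  next
    case False
    show ?thesis by (rule that[OF _ le]) (use False in auto)
  qed
  obtain J where "J \<subseteq> S" "card J = m + 1"
    using obtain_subset_with_card_n[OF S(2)] by blast
  then show ?thesis using that[of J] S m by auto
qed

text \<open>The larger of the real and imaginary errors carries at least half of the modulus, and
  the majority belonging to this one part suffices. Intersecting the majorities of both parts could
  leave a single index.\<close>

lemma cmedian_index_set: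
  assumes "odd (length ys)"
  obtains J where "J \<subseteq> {..<length ys}" "card J = (length ys + 1) div 2"
    "\<And>j. j \<in> J \<Longrightarrow> cmod (cmedian ys - c) \<le> 2 * cmod (ys ! j - c)"
proof -
  let ?w = "cmedian ys - c"
  have norm: "cmod ?w \<le> \<bar>Re ?w\<bar> + \<bar>Im ?w\<bar>" by (rule cmod_le)
  show ?thesis
  proof (cases "\<bar>Im ?w\<bar> \<le> \<bar>Re ?w\<bar>")
    case True
    obtain J where J: "J \<subseteq> {..<length ys}" "card J = (length ys + 1) div 2"
      "\<And>j. j \<in> J \<Longrightarrow> \<bar>median (map Re ys) - Re c\<bar> \<le> \<bar>map Re ys ! j - Re c\<bar>"
      using median_index_set[of "map Re ys" "Re c"] assms by auto
    show ?thesis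
    proof (rule that[OF J(1,2)])
      fix j assume j: "j \<in> J"
      then have "\<bar>Re ?w\<bar> \<le> \<bar>Re (ys ! j - c)\<bar>"
        using J(1) J(3)[OF j] by (auto simp: cmedian_def)
      also have "\<dots> \<le> cmod (ys ! j - c)" by (rule abs_Re_le_cmod)
      finally show "cmod ?w \<le> 2 * cmod (ys ! j - c)" using norm True by linarith
    qed
  next
    case False
    obtain J where J: "J \<subseteq> {..<length ys}" "card J = (length ys + 1) div 2"
      "\<And>j. j \<in> J \<Longrightarrow> \<bar>median (map Im ys) - Im c\<bar> \<le> \<bar>map Im ys ! j - Im c\<bar>"
      using median_index_set[of "map Im ys" "Im c"] assms by auto
    show ?thesis
    proof (rule that[OF J(1,2)])
      fix j assume j: "j \<in> J"
      then have "\<bar>Im ?w\<bar> \<le> \<bar>Im (ys ! j - c)\<bar>"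
        using J(1) J(3)[OF j] by (auto simp: cmedian_def)
      also have "\<dots> \<le> cmod (ys ! j - c)" by (rule abs_Im_le_cmod)
      finally show "cmod ?w \<le> 2 * cmod (ys ! j - c)" using norm False by linarith
    qed
  qed
qed

lemma median_quad_index_set:
  assumes "odd t"
  obtains J where "J \<subseteq> {1..t}" "card J = (t + 1) div 2"
    "\<And>j. j \<in> J \<Longrightarrow> cmod (median_quad d f N L r t \<omega> - c) \<le> 2 * cmod (quad d f N L r (\<omega> j) - c)"
proof -
  let ?ys = "map (\<lambda>j. quad d f N L r (\<omega> j)) [1..<Suc t]"
  obtain J where J: "J \<subseteq> {..<t}" "card J = (t + 1) div 2"
    "\<And>j. j \<in> J \<Longrightarrow> cmod (cmedian ?ys - c) \<le> 2 * cmod (?ys ! j - c)"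
    using cmedian_index_set[of ?ys c] assms by (auto simp del: upt_Suc)
  show ?thesis
  proof (rule that[of "Suc ` J"])
    show "card (Suc ` J) = (t + 1) div 2" using J(2) by (simp add: card_image)
    fix j assume "j \<in> Suc ` J"
    then obtain i where "j = Suc i" "i \<in> J" by blast
    then show "cmod (median_quad d f N L r t \<omega> - c) \<le> 2 * cmod (quad d f N L r (\<omega> j) - c)"
      using J(1) J(3)[of i] by (auto simp: median_quad_def simp del: upt_Suc)
  qed (use J(1) in auto)
qed

text \<open>The elementary symmetric polynomial of degree \<open>(t + 1) div 2\<close> in
  \<open>X (\<omega> 1)\<close>, ..., \<open>X (\<omega> t)\<close>. Each of its monomials involves
  distinct copies, so independence evaluates its expectation.\<close>

definition prod_sums :: "nat \<Rightarrow> ('a \<Rightarrow> real) \<Rightarrow> (nat \<Rightarrow> 'a) \<Rightarrow> real" where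
  "prod_sums t X \<omega> = (\<Sum>J | J \<subseteq> {1..t} \<and> card J = (t + 1) div 2. \<Prod>j\<in>J. X (\<omega> j))"

lemma finite_set_Pi_pmf:
  assumes "finite A" "\<And>x. x \<in> A \<Longrightarrow> finite (set_pmf (p x))"
  shows "finite (set_pmf (Pi_pmf A dflt p))"
  unfolding set_Pi_pmf[OF assms(1)] using assms by (intro finite_PiE_dflt) auto

lemma expectation_prod_sums:
  assumes fin: "finite (set_pmf p)" and X0: "\<And>x. 0 \<le> X x" and a: "measure_pmf.expectation p X \<le> a"
  shows "measure_pmf.expectation (Pi_pmf {1..t} undefined (\<lambda>_. p)) (prod_sums t X) \<le> 2 ^ t * a ^ ((t + 1) div 2)"
proof -
  let ?q = "Pi_pmf {1..t} undefined (\<lambda>_. p)" and ?s = "(t + 1) div 2"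
  let ?\<J> = "{J. J \<subseteq> {1..t} \<and> card J = ?s}"
  have finq: "finite (set_pmf ?q)" using fin by (intro finite_set_Pi_pmf) auto
  have E0: "0 \<le> measure_pmf.expectation p X" using X0 by simp
  have a0: "0 \<le> a" using E0 a by linarith
  have one: "measure_pmf.expectation ?q (\<lambda>\<omega>. \<Prod>j\<in>J. X (\<omega> j)) \<le> a ^ ?s" if J: "J \<in> ?\<J>" for J
  proof -
    \<comment> \<open>A product over \<open>J\<close> is padded with constant factors 1 to a product
      over all of \<open>{1..t}\<close>, the form in which independence under \<open>Pi_pmf\<close>
      applies.\<close>
    have split: "(\<Prod>j\<in>{1..t}. if j \<in> J then g j else 1) = (\<Prod>j\<in>J. g j)" for g :: "nat \<Rightarrow> real"
      using J by (simp add: prod.If_cases Int_absorb1)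
    have "measure_pmf.expectation ?q (\<lambda>\<omega>. \<Prod>j\<in>J. X (\<omega> j)) =
       measure_pmf.expectation ?q (\<lambda>\<omega>. \<Prod>j\<in>{1..t}. (if j \<in> J then X else (\<lambda>_. 1)) (\<omega> j))"
      unfolding split[symmetric] by (simp add: if_distrib[of "\<lambda>h. h _"])
    also have "\<dots> = (\<Prod>j\<in>{1..t}. measure_pmf.expectation p (if j \<in> J then X else (\<lambda>_. 1)))"
      using X0 by (intro expectation_prod_Pi_pmf integrable_measure_pmf_finite fin) auto
    also have "\<dots> = (\<Prod>j\<in>{1..t}. if j \<in> J then measure_pmf.expectation p X else 1)"
      by (intro prod.cong refl) simp
    also have "\<dots> = measure_pmf.expectation p X ^ ?s"
      unfolding split using J by simp
    also have "\<dots> \<le> a ^ ?s"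
      by (rule power_mono[OF a E0])
    finally show ?thesis .
  qed
  have "measure_pmf.expectation ?q (prod_sums t X) =
      (\<Sum>J\<in>?\<J>. measure_pmf.expectation ?q (\<lambda>\<omega>. \<Prod>j\<in>J. X (\<omega> j)))"
    unfolding prod_sums_def by (intro Bochner_Integration.integral_sum integrable_measure_pmf_finite finq)
  also have "\<dots> \<le> (\<Sum>J\<in>?\<J>. a ^ ?s)"
    by (intro sum_mono one)
  also have "\<dots> = real (card ?\<J>) * a ^ ?s" by simp
  also have "\<dots> \<le> 2 ^ t * a ^ ?s"
  proof (rule mult_right_mono)
    have "card ?\<J> \<le> card (Pow {1..t})" by (intro card_mono) auto
    then have "real (card ?\<J>) \<le> real (2 ^ t)" by (intro of_nat_mono) (simp add: card_Pow)
    then show "real (card ?\<J>) \<le> 2 ^ t" by simp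
  qed (use a0 in simp)
  finally show ?thesis .
qed

lemma power_le_prod_sums:
  assumes X0: "\<And>x. 0 \<le> X x" and v: "0 \<le> v"
    and J: "J \<subseteq> {1..t}" "card J = (t + 1) div 2" "\<And>j. j \<in> J \<Longrightarrow> v \<le> X (\<omega> j)"
  shows "v ^ ((t + 1) div 2) \<le> prod_sums t X \<omega>"
proof -
  have "v ^ ((t + 1) div 2) = (\<Prod>j\<in>J. v)" using J(2) by simp
  also have "\<dots> \<le> (\<Prod>j\<in>J. X (\<omega> j))" using v J(3) by (intro prod_mono) auto
  also have "\<dots> \<le> prod_sums t X \<omega>"
    unfolding prod_sums_def
    by (rule member_le_sum[where f = "\<lambda>J. \<Prod>j\<in>J. X (\<omega> j)"]) (use J X0 in \<open>auto intro!: prod_nonneg\<close>)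
  finally show ?thesis .
qed

section \<open>Tail and second moment of a variable dominated by a majority\<close>

context
  fixes p :: "'a pmf" and X :: "'a \<Rightarrow> real" and a :: real and t :: nat and V :: "(nat \<Rightarrow> 'a) \<Rightarrow> real"
  assumes fin: "finite (set_pmf p)" and X0: "\<And>x. 0 \<le> X x"
    and a: "measure_pmf.expectation p X \<le> a" "0 < a"
    and V0: "\<And>\<omega>. 0 \<le> V \<omega>" and V: "\<And>\<omega>. V \<omega> ^ ((t + 1) div 2) \<le> prod_sums t X \<omega>"
begin

text \<open>With \<open>s = (t + 1) div 2\<close>, Markov's inequality for \<open>prod_sums\<close>
  at level \<open>(a / \<sigma>)^s\<close> leaves \<open>2^t * \<sigma>^s\<close>. This is at most
  \<open>(2 * sqrt \<sigma>)^t\<close>, because \<open>2 * s \<ge> t\<close> and \<sigma> \<le>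
  1.\<close>

lemma majority_tail:
  assumes \<sigma>: "0 < \<sigma>" "\<sigma> \<le> 1"
  shows "measure_pmf.prob (Pi_pmf {1..t} undefined (\<lambda>_. p)) {\<omega>. a / \<sigma> \<le> V \<omega>} \<le> (2 * sqrt \<sigma>) ^ t"
proof -
  let ?q = "Pi_pmf {1..t} undefined (\<lambda>_. p)" and ?s = "(t + 1) div 2"
  have finq: "finite (set_pmf ?q)" using fin by (intro finite_set_Pi_pmf) auto
  have as: "0 < (a / \<sigma>) ^ ?s" using a \<sigma> by simp
  have "measure_pmf.prob ?q {\<omega>. a / \<sigma> \<le> V \<omega>} \<le> measure_pmf.prob ?q {\<omega>. (a / \<sigma>) ^ ?s \<le> prod_sums t X \<omega>}"
  proof (intro measure_pmf.finite_measure_mono Collect_mono impI)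
    fix \<omega> assume "a / \<sigma> \<le> V \<omega>"
    then have "(a / \<sigma>) ^ ?s \<le> V \<omega> ^ ?s" using a \<sigma> by (intro power_mono) auto
    then show "(a / \<sigma>) ^ ?s \<le> prod_sums t X \<omega>" using V by (rule order_trans)
  qed simp
  also have "\<dots> \<le> measure_pmf.expectation ?q (prod_sums t X) / (a / \<sigma>) ^ ?s"
    using integral_Markov_inequality_measure[OF integrable_measure_pmf_finite[OF finq], of UNIV "prod_sums t X" "(a / \<sigma>) ^ ?s"]
      as order_trans[OF zero_le_power[OF V0] V] by simp
  also have "\<dots> \<le> 2 ^ t * a ^ ?s / (a / \<sigma>) ^ ?s"
    using as by (intro divide_right_mono expectation_prod_sums[OF fin X0 a(1)]) auto
  also have "\<dots> = 2 ^ t * \<sigma> ^ ?s"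
    using a by (simp add: power_divide)
  also have "\<dots> = 2 ^ t * sqrt \<sigma> ^ (2 * ?s)"
    using \<sigma> by (simp add: power_mult)
  also have "\<dots> \<le> 2 ^ t * sqrt \<sigma> ^ t"
    using \<sigma> by (intro mult_left_mono power_decreasing) auto
  finally show ?thesis by (simp add: power_mult_distrib)
qed

lemma majority_second_moment:
  assumes t: "7 \<le> t" "odd t"
  shows "measure_pmf.expectation (Pi_pmf {1..t} undefined (\<lambda>_. p)) (\<lambda>\<omega>. (V \<omega>)\<^sup>2) \<le> 24 * a\<^sup>2"
proof -
  let ?q = "Pi_pmf {1..t} undefined (\<lambda>_. p)"
  obtain m where m: "t = 2 * m + 1" "3 \<le> m" using t by (auto elim!: oddE)
  have s: "(t + 1) div 2 = (m - 1) + 2" using m by simp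
  have finq: "finite (set_pmf ?q)" using fin by (intro finite_set_Pi_pmf) auto
  have K0: "0 < (4 * a) ^ (m - 1)" using a by simp
  \<comment> \<open>Above the threshold \<open>4 * a\<close>, all but two of the
    \<open>m + 1\<close> factors of the power of \<open>V\<close> are replaced by the threshold. The
    4 is chosen so that \<open>4^(m - 1)\<close> cancels \<open>2^t\<close> up to a factor 8; hence
    \<open>16 + 8 = 24\<close>, independently of \<open>t\<close>.\<close>
  have pw: "(V \<omega>)\<^sup>2 \<le> (4 * a)\<^sup>2 + prod_sums t X \<omega> / (4 * a) ^ (m - 1)" for \<omega>
  proof -
    have VP: "V \<omega> ^ (m - 1) * (V \<omega>)\<^sup>2 \<le> prod_sums t X \<omega>"
      using V[of \<omega>] unfolding s power_add .
    have P0: "0 \<le> prod_sums t X \<omega>" using order_trans[OF zero_le_power[OF V0] V] .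
    show ?thesis
    proof (cases "V \<omega> \<le> 4 * a")
      case True
      then have "(V \<omega>)\<^sup>2 \<le> (4 * a)\<^sup>2" by (intro power_mono V0)
      then show ?thesis using P0 K0 by (simp add: add_increasing2)
    next
      case False
      then have "(4 * a) ^ (m - 1) * (V \<omega>)\<^sup>2 \<le> V \<omega> ^ (m - 1) * (V \<omega>)\<^sup>2"
        using a by (intro mult_right_mono power_mono) auto
      then have "(4 * a) ^ (m - 1) * (V \<omega>)\<^sup>2 \<le> prod_sums t X \<omega>" using VP by linarith
      then have "(V \<omega>)\<^sup>2 \<le> prod_sums t X \<omega> / (4 * a) ^ (m - 1)"
        using K0 by (simp add: pos_le_divide_eq mult.commute)
      then show ?thesis by (simp add: add_increasing)
    qed
  qed
  have "measure_pmf.expectation ?q (\<lambda>\<omega>. (V \<omega>)\<^sup>2)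
      \<le> measure_pmf.expectation ?q (\<lambda>\<omega>. (4 * a)\<^sup>2 + prod_sums t X \<omega> / (4 * a) ^ (m - 1))"
    by (intro integral_mono integrable_measure_pmf_finite finq pw)
  also have "\<dots> = (4 * a)\<^sup>2 + measure_pmf.expectation ?q (prod_sums t X) / (4 * a) ^ (m - 1)"
    by (subst Bochner_Integration.integral_add) (use finq in \<open>auto intro!: integrable_measure_pmf_finite\<close>)
  also have "\<dots> \<le> (4 * a)\<^sup>2 + 2 ^ t * a ^ ((m - 1) + 2) / (4 * a) ^ (m - 1)"
    using expectation_prod_sums[OF fin X0 a(1), of t] K0 unfolding s
    by (intro add_left_mono divide_right_mono) auto
  also have "2 ^ t * a ^ ((m - 1) + 2) / (4 * a) ^ (m - 1) = 8 * a\<^sup>2"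
  proof -
    have "(2::real) ^ t = 2 ^ (2 * (m - 1) + 3)" using m by (intro arg_cong[where f = "power 2"]) simp
    also have "\<dots> = 8 * 4 ^ (m - 1)" by (simp add: power_add power_mult)
    finally show ?thesis using a by (simp add: power_add power_mult_distrib power2_eq_square)
  qed
  finally show ?thesis by (simp add: power_mult_distrib)
qed

end

section \<open>Choice of parameters and final bounds\<close>

lemma parameter_bounds:
  fixes n \<sigma> \<epsilon> r :: real and B L :: int
  assumes n: "2 < n" and \<sigma>: "0 < \<sigma>" "\<sigma> \<le> 1/10" and \<epsilon>: "0 < \<epsilon>" "\<epsilon> < \<sigma> / n"
    and B: "B = \<lceil>4 * n / \<sigma>\<rceil>" and r: "r = real_of_int B * sqrt (ln (1 / \<epsilon>))"
    and L: "L = \<lceil>r * sqrt (2 * ln (1 / \<epsilon>))\<rceil>"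
  shows "\<epsilon> \<le> 1/2" "80 \<le> r" "r \<le> real_of_int L" "exp (- ((real_of_int L)\<^sup>2 / (2 * r\<^sup>2))) \<le> \<epsilon>"
    "\<epsilon>\<^sup>2 \<le> 5 / r" "1 / (r * \<sigma>) \<le> 3 * (ln (1 / \<epsilon>) / (real_of_int L * \<sigma>))"
proof -
  let ?\<Lambda> = "ln (1 / \<epsilon>)"
  have "\<sigma> / n \<le> (1/10) / 2" using n \<sigma> by (intro frac_le) auto
  then have e20: "\<epsilon> \<le> 1/20" using \<epsilon> by linarith
  then show "\<epsilon> \<le> 1/2" by simp
  have "exp 1 \<le> (3::real)" by (rule exp_le)
  also have "3 \<le> 1 / \<epsilon>" using e20 \<epsilon>(1) by (simp add: field_simps)
  finally have \<Lambda>: "1 \<le> ?\<Lambda>" using \<epsilon>(1) by (simp add: ln_ge_iff)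
  have \<Lambda>\<epsilon>: "?\<Lambda> \<le> 1 / \<epsilon>" using ln_le_minus_one[of "1 / \<epsilon>"] \<epsilon>(1) by simp
  have s\<Lambda>: "1 \<le> sqrt ?\<Lambda>" "sqrt ?\<Lambda> \<le> ?\<Lambda>"
    using \<Lambda> real_le_lsqrt[of ?\<Lambda> ?\<Lambda>] self_le_power[of ?\<Lambda> 2] by auto
  have "4 * 2 / (1/10) \<le> 4 * n / \<sigma>" using n \<sigma> by (intro frac_le) auto
  then have B80: "80 \<le> real_of_int B"
    unfolding B using le_of_int_ceiling[of "4 * n / \<sigma>"] by simp
  have B1: "real_of_int B \<le> 4 * n / \<sigma> + 1"
    unfolding B by (rule of_int_ceiling_le_add_one)
  have "80 * 1 \<le> r" unfolding r using B80 s\<Lambda> by (intro mult_mono) auto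
  then show r80: "80 \<le> r" by simp
  have L1: "r * sqrt (2 * ?\<Lambda>) \<le> real_of_int L" "real_of_int L \<le> r * sqrt (2 * ?\<Lambda>) + 1"
    unfolding L by linarith+
  have "1 \<le> sqrt (2 * ?\<Lambda>)" using \<Lambda> by simp
  then have "r * 1 \<le> r * sqrt (2 * ?\<Lambda>)" using r80 by (intro mult_left_mono) auto
  then show rL: "r \<le> real_of_int L" using L1 by simp
  \<comment> \<open>The origin of the truncation length: it makes the exponent
    \<open>L^2 / (2 * r^2)\<close> at least \<open>ln (1 / \<epsilon>)\<close>.\<close>
  have "(r * sqrt (2 * ?\<Lambda>))\<^sup>2 \<le> (real_of_int L)\<^sup>2"
    using L1(1) r80 \<Lambda> by (intro power_mono) auto
  then have "2 * r\<^sup>2 * ?\<Lambda> \<le> (real_of_int L)\<^sup>2"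
    using \<Lambda> by (simp add: power_mult_distrib mult_ac)
  then have "?\<Lambda> \<le> (real_of_int L)\<^sup>2 / (2 * r\<^sup>2)"
    using r80 by (simp add: pos_le_divide_eq mult_ac)
  then have "exp (- ((real_of_int L)\<^sup>2 / (2 * r\<^sup>2))) \<le> exp (- ?\<Lambda>)" by simp
  also have "\<dots> = \<epsilon>" using \<epsilon>(1) by (simp add: ln_div)
  finally show "exp (- ((real_of_int L)\<^sup>2 / (2 * r\<^sup>2))) \<le> \<epsilon>" .
  \<comment> \<open>The relation \<epsilon> < \<sigma> / n bounds \<open>B\<close> by
    \<open>5 / \<epsilon>\<close>, hence \<open>r\<close> by \<open>5 / \<epsilon>^2\<close>; this
    is the condition that controls the jumps at the cutoff.\<close>
  have "4 * n / \<sigma> \<le> 4 / \<epsilon>"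
    using \<epsilon> n \<sigma> by (simp add: field_simps)
  moreover have "1 \<le> 1 / \<epsilon>" using e20 \<epsilon>(1) by simp
  ultimately have "real_of_int B \<le> 5 / \<epsilon>" using B1 by (simp add: add_divide_distrib[symmetric])
  moreover have "sqrt ?\<Lambda> \<le> 1 / \<epsilon>" using s\<Lambda>(2) \<Lambda>\<epsilon> by linarith
  ultimately have "r \<le> 5 / \<epsilon> * (1 / \<epsilon>)"
    unfolding r by (rule mult_mono) (use \<epsilon>(1) e20 in auto)
  then show "\<epsilon>\<^sup>2 \<le> 5 / r"
    using \<epsilon>(1) r80 by (simp add: field_simps power2_eq_square)
  have "sqrt (2 * ?\<Lambda>) \<le> 2 * ?\<Lambda>"
    using \<Lambda> self_le_power[of "2 * ?\<Lambda>" 2] by (intro real_le_lsqrt) auto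
  then have "r * sqrt (2 * ?\<Lambda>) \<le> r * (2 * ?\<Lambda>)" using r80 by (intro mult_left_mono) auto
  moreover have "1 * 1 \<le> r * ?\<Lambda>" using r80 \<Lambda> by (intro mult_mono) auto
  \<comment> \<open>The 3 is 2 from \<open>sqrt (2 * ?\<Lambda>) \<le> 2 * ?\<Lambda>\<close> plus 1
    for the rounding in \<open>L\<close>, which \<open>r * ?\<Lambda> \<ge> 1\<close>
    absorbs.\<close>
  ultimately have "real_of_int L \<le> 3 * ?\<Lambda> * r" using L1(2) by (simp add: mult_ac)
  then show "1 / (r * \<sigma>) \<le> 3 * (?\<Lambda> / (real_of_int L * \<sigma>))"
    using r80 rL \<sigma> by (simp add: field_simps)
qed

lemma quadrature_bounds:
  fixes d :: nat and \<kappa> N\<kappa> :: "real \<Rightarrow> real" and f :: "(nat \<Rightarrow> real) \<Rightarrow> complex"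
    and n \<sigma> \<epsilon> r :: real and B L :: int and N :: nat
  assumes \<kappa>1: "\<forall>x>0. \<kappa> x \<ge> 1" and \<kappa>: "mono_on {0<..} \<kappa>"
    and N\<kappa>: "\<forall>e. 0 < e \<and> e \<le> 1/2 \<longrightarrow> N\<kappa> e > 0 \<and> \<kappa> (N\<kappa> e) \<ge> 1 / e"
    and f: "f \<in> A_space d \<kappa>" "A_norm d \<kappa> f \<le> 1"
    and n: "n > 2" and \<sigma>: "0 < \<sigma>" "\<sigma> \<le> 1/10" and \<epsilon>: "0 < \<epsilon>" "\<epsilon> < \<sigma> / n"
    and B: "B = \<lceil>4 * n / \<sigma>\<rceil>" and r: "r = real_of_int B * sqrt (ln (1 / \<epsilon>))"
    and L: "L = \<lceil>r * sqrt (2 * ln (1 / \<epsilon>))\<rceil>"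
    and N: "prime N" "int N \<ge> max \<lceil>N\<kappa> \<epsilon>\<rceil> (3 * L)"
  defines "\<delta> \<equiv> ln (1 / \<epsilon>) / (real_of_int L * \<sigma>) + \<epsilon>"
  shows "measure_pmf.prob (Hz_pmf d N) {\<omega>. cmod (quad d f N L r \<omega> - INT_f d f) \<le> 500 * \<delta>} \<ge> 1 - \<sigma>"
    and "odd t \<Longrightarrow>
      measure_pmf.prob (Hz_copies_pmf d N t)
        {\<omega>. cmod (median_quad d f N L r t \<omega> - INT_f d f) \<le> 500 * \<delta>} \<ge> 1 - (2 * sqrt \<sigma>) ^ t"
    and "odd t \<Longrightarrow> 7 \<le> t \<Longrightarrow>
      sqrt (measure_pmf.expectation (Hz_copies_pmf d N t)
        (\<lambda>\<omega>. (cmod (median_quad d f N L r t \<omega> - INT_f d f))\<^sup>2)) \<le> 500 * \<delta>"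
proof -
  note pb = parameter_bounds[OF n \<sigma> \<epsilon> B r L]
  have r0: "0 < r" using pb by simp
  have L80: "80 \<le> L" using pb(2,3) by linarith
  have N\<kappa>\<epsilon>: "0 < N\<kappa> \<epsilon>" "1 / \<epsilon> \<le> \<kappa> (N\<kappa> \<epsilon>)" using N\<kappa> pb(1) \<epsilon>(1) by auto
  have "N\<kappa> \<epsilon> \<le> real N" using N(2) by linarith
  then have "\<kappa> (N\<kappa> \<epsilon>) \<le> \<kappa> (real N)"
    using N\<kappa>\<epsilon> by (intro mono_onD[OF \<kappa>]) auto
  then have \<kappa>N: "1 / \<epsilon> \<le> \<kappa> (real N)" using N\<kappa>\<epsilon> by simp
  have q2: "(exp (- ((real_of_int L)\<^sup>2 / (2 * r\<^sup>2))))\<^sup>2 \<le> 5 / r"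
    using power_mono[OF pb(4), of 2] pb(5) by simp
  obtain X where X: "\<And>\<omega>. 0 \<le> X \<omega>"
    "\<And>\<omega>. cmod (quad d f N L r \<omega> - INT_f d f) \<le> 1 / (2 * r) + 6 * \<epsilon> + X \<omega>"
    "measure_pmf.expectation (Hz_pmf d N) X \<le> 10 / r"
    using quadrature_error[OF _ \<kappa> \<kappa>N \<epsilon>(1) f N(1), of L r] \<kappa>1 N(2) pb(2,3,4) L80 q2 by auto
  define D where "D = 1 / (2 * r) + 6 * \<epsilon>"
  define a where "a = 10 / r"
  have D0: "0 < D" and a0: "0 < a" using r0 \<epsilon> by (auto simp: D_def a_def add_pos_pos)
  have E0: "0 \<le> ln (1 / \<epsilon>) / (real_of_int L * \<sigma>)"
    using pb(1) \<epsilon>(1) L80 \<sigma> by (intro divide_nonneg_nonneg) auto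
  have r\<sigma>: "1 / r \<le> 1 / (r * \<sigma>)"
    using r0 \<sigma> by (intro divide_left_mono) (auto simp: mult_left_le)
  \<comment> \<open>With \<open>E = ln (1 / \<epsilon>) / (L * \<sigma>)\<close> and
    \<open>1 / r \<le> 1 / (r * \<sigma>) \<le> 3 * E\<close>, the left sides are at most
    \<open>63 * E + 12 * \<epsilon>\<close> and \<open>424.5 * E + 18 * \<epsilon>\<close>. The
    second, which comes from the second moment, dictates the size of the constant 500.\<close>
  have bound: "2 * (D + a / \<sigma>) \<le> 500 * \<delta>" and bound2: "3 * D + 14 * a \<le> 500 * \<delta>"
  proof -
    have gen: "2 * (y / 2 + 6 * e + 10 * x) \<le> 500 * (E + e)" "3 * (y / 2 + 6 * e) + 14 * (10 * y) \<le> 500 * (E + e)"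
      if "y \<le> x" "x \<le> 3 * E" "0 \<le> E" "0 < e" for x y E e :: real
      using that by argo+
    have eqs: "a / \<sigma> = 10 * (1 / (r * \<sigma>))" "D = (1 / r) / 2 + 6 * \<epsilon>" "a = 10 * (1 / r)"
      by (simp_all add: a_def D_def)
    show "2 * (D + a / \<sigma>) \<le> 500 * \<delta>"
      unfolding eqs(1,2) \<delta>_def by (rule gen(1)[OF r\<sigma> pb(6) E0 \<epsilon>(1)])
    show "3 * D + 14 * a \<le> 500 * \<delta>"
      unfolding eqs(2,3) \<delta>_def by (rule gen(2)[OF r\<sigma> pb(6) E0 \<epsilon>(1)])
  qed
  have N2: "2 \<le> N" using N(1) prime_ge_2_nat by blast
  note fin = finite_set_Hz_pmf[OF N2, of d]
  have prob_compl: "1 - b \<le> measure_pmf.prob q {\<omega>. h \<omega> \<le> 500 * \<delta>}"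
    if "measure_pmf.prob q {\<omega>. c \<le> V \<omega>} \<le> b" "\<And>\<omega>. V \<omega> < c \<Longrightarrow> h \<omega> \<le> 500 * \<delta>"
    for q :: "'x pmf" and h V :: "'x \<Rightarrow> real" and b c
  proof -
    have "measure_pmf.prob q (- {\<omega>. c \<le> V \<omega>}) = 1 - measure_pmf.prob q {\<omega>. c \<le> V \<omega>}"
      using measure_pmf.prob_compl[of "{\<omega>. c \<le> V \<omega>}" q] by (simp add: Compl_eq_Diff_UNIV)
    moreover have "measure_pmf.prob q (- {\<omega>. c \<le> V \<omega>}) \<le> measure_pmf.prob q {\<omega>. h \<omega> \<le> 500 * \<delta>}"
      by (intro measure_pmf.finite_measure_mono) (use that(2) in force)+
    ultimately show ?thesis using that(1) by linarith
  qed
  show "measure_pmf.prob (Hz_pmf d N) {\<omega>. cmod (quad d f N L r \<omega> - INT_f d f) \<le> 500 * \<delta>} \<ge> 1 - \<sigma>"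
  proof (rule prob_compl)
    have "measure_pmf.prob (Hz_pmf d N) {\<omega>. a / \<sigma> \<le> X \<omega>}
        \<le> measure_pmf.expectation (Hz_pmf d N) X / (a / \<sigma>)"
      using integral_Markov_inequality_measure[OF integrable_measure_pmf_finite[OF fin], of UNIV X "a / \<sigma>"]
        X(1) a0 \<sigma> by simp
    also have "\<dots> \<le> a / (a / \<sigma>)"
      using X(3) a0 \<sigma> by (intro divide_right_mono) (auto simp: a_def)
    finally show "measure_pmf.prob (Hz_pmf d N) {\<omega>. a / \<sigma> \<le> X \<omega>} \<le> \<sigma>"
      using a0 by simp
    fix \<omega> assume "X \<omega> < a / \<sigma>"
    then have "cmod (quad d f N L r \<omega> - INT_f d f) \<le> D + a / \<sigma>"
      using X(2)[of \<omega>] unfolding D_def by linarith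
    moreover have "0 \<le> a / \<sigma>" using a0 \<sigma> by simp
    ultimately show "cmod (quad d f N L r \<omega> - INT_f d f) \<le> 500 * \<delta>"
      using bound D0 by argo
  qed
  define err where "err = (\<lambda>\<omega>. cmod (median_quad d f N L r t \<omega> - INT_f d f))"
  have err_eq: "cmod (median_quad d f N L r t \<omega> - INT_f d f) = err \<omega>" for \<omega> by (simp add: err_def)
  \<comment> \<open>Half of the median's error, beyond the deterministic part \<open>D\<close>. The
    halving undoes the factor 2 of \<open>median_quad_index_set\<close>, so that
    \<open>V \<omega> \<le> X (\<omega> j)\<close> on a majority of copies; the \<open>max\<close>
    keeps \<open>V\<close> nonnegative for taking powers.\<close>
  define V where "V = (\<lambda>\<omega>. max 0 (err \<omega> / 2 - D))"
  have V0: "0 \<le> V \<omega>" for \<omega> by (simp add: V_def)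
  have errV: "err \<omega> \<le> 2 * (D + V \<omega>)" for \<omega> by (simp add: V_def max_def)
  have V: "V \<omega> ^ ((t + 1) div 2) \<le> prod_sums t X \<omega>" if t: "odd t" for \<omega>
  proof -
    obtain J where J: "J \<subseteq> {1..t}" "card J = (t + 1) div 2"
      "\<And>j. j \<in> J \<Longrightarrow> err \<omega> \<le> 2 * cmod (quad d f N L r (\<omega> j) - INT_f d f)"
      unfolding err_def
      by (rule median_quad_index_set[OF t, where \<omega> = \<omega> and d = d and f = f and N = N and L = L and r = r and c = "INT_f d f"]) blast
    have "V \<omega> \<le> X (\<omega> j)" if "j \<in> J" for j
      using J(3)[OF that] X(1)[of "\<omega> j"] X(2)[of "\<omega> j"] unfolding V_def D_def by simp
    then show ?thesis using J by (intro power_le_prod_sums X(1) V0)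
  qed
  let ?q = "Hz_copies_pmf d N t"
  have finq: "finite (set_pmf ?q)"
    unfolding Hz_copies_pmf_def using fin by (intro finite_set_Pi_pmf) auto
  show "measure_pmf.prob ?q {\<omega>. cmod (median_quad d f N L r t \<omega> - INT_f d f) \<le> 500 * \<delta>} \<ge> 1 - (2 * sqrt \<sigma>) ^ t"
    if t: "odd t"
    unfolding err_eq
  proof (rule prob_compl)
    show "measure_pmf.prob ?q {\<omega>. a / \<sigma> \<le> V \<omega>} \<le> (2 * sqrt \<sigma>) ^ t"
      unfolding Hz_copies_pmf_def
      by (rule majority_tail[OF fin X(1) X(3)[folded a_def] a0 V0 V[OF t] \<sigma>(1)]) (use \<sigma> in simp)
    fix \<omega> assume "V \<omega> < a / \<sigma>"
    then show "err \<omega> \<le> 500 * \<delta>" using errV[of \<omega>] bound by argo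
  qed
  show "sqrt (measure_pmf.expectation ?q (\<lambda>\<omega>. (cmod (median_quad d f N L r t \<omega> - INT_f d f))\<^sup>2)) \<le> 500 * \<delta>"
    if t: "odd t" "7 \<le> t"
    unfolding err_eq
  proof -
    have "(err \<omega>)\<^sup>2 \<le> 8 * D\<^sup>2 + 8 * (V \<omega>)\<^sup>2" for \<omega>
    proof -
      have "(err \<omega>)\<^sup>2 \<le> (2 * (D + V \<omega>))\<^sup>2"
        by (rule power_mono[OF errV]) (simp add: err_def)
      also have "\<dots> \<le> 8 * D\<^sup>2 + 8 * (V \<omega>)\<^sup>2"
        using zero_le_power2[of "D - V \<omega>"] by (simp add: power2_eq_square algebra_simps)
      finally show ?thesis .
    qed
    then have "measure_pmf.expectation ?q (\<lambda>\<omega>. (err \<omega>)\<^sup>2) \<le> measure_pmf.expectation ?q (\<lambda>\<omega>. 8 * D\<^sup>2 + 8 * (V \<omega>)\<^sup>2)"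
      by (intro integral_mono integrable_measure_pmf_finite finq)
    also have "\<dots> = 8 * D\<^sup>2 + 8 * measure_pmf.expectation ?q (\<lambda>\<omega>. (V \<omega>)\<^sup>2)"
      by (subst Bochner_Integration.integral_add) (use finq in \<open>auto intro!: integrable_measure_pmf_finite\<close>)
    also have "\<dots> \<le> 8 * D\<^sup>2 + 8 * (24 * a\<^sup>2)"
      using majority_second_moment[OF fin X(1) X(3)[folded a_def] a0 V0 V[OF t(1)] t(2,1)]
      by (simp add: Hz_copies_pmf_def)
    \<comment> \<open>The coefficients 3 and 14 are the least integers with
      \<open>8 \<le> 3^2\<close> and \<open>8 * 24 = 192 \<le> 14^2\<close>.\<close>
    also have "\<dots> \<le> (3 * D + 14 * a)\<^sup>2"
      using D0 a0 mult_pos_pos[OF D0 a0] by (simp add: power2_sum power_mult_distrib)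
    finally have "sqrt (measure_pmf.expectation ?q (\<lambda>\<omega>. (err \<omega>)\<^sup>2)) \<le> 3 * D + 14 * a"
      using D0 a0 by (intro real_le_lsqrt) auto
    then show "sqrt (measure_pmf.expectation ?q (\<lambda>\<omega>. (err \<omega>)\<^sup>2)) \<le> 500 * \<delta>"
      using bound2 by linarith
  qed
qed

theorem theorem4p5:
  "\<exists>C::real. C > 0 \<and>
    (\<forall>(d::nat) (\<kappa>::real \<Rightarrow> real) (N\<kappa>::real \<Rightarrow> real) (f::(nat \<Rightarrow> real) \<Rightarrow> complex)
       (n::real) (\<sigma>::real) (\<epsilon>::real) (B::int) (r::real) (L::int) (N::nat).
      d \<ge> 1 \<longrightarrow>
      (\<forall>x>0. \<kappa> x \<ge> 1) \<longrightarrow>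
      mono_on {0<..} \<kappa> \<longrightarrow>
      (\<forall>e. 0 < e \<and> e \<le> 1/2 \<longrightarrow> N\<kappa> e > 0 \<and> \<kappa> (N\<kappa> e) \<ge> 1 / e) \<longrightarrow>
      f \<in> A_space d \<kappa> \<longrightarrow>
      A_norm d \<kappa> f \<le> 1 \<longrightarrow>
      n > 2 \<longrightarrow>
      0 < \<sigma> \<longrightarrow> \<sigma> \<le> 1/10 \<longrightarrow>
      0 < \<epsilon> \<longrightarrow> \<epsilon> < \<sigma> / n \<longrightarrow>
      B = \<lceil>4 * n / \<sigma>\<rceil> \<longrightarrow>
      r = real_of_int B * sqrt (ln (1 / \<epsilon>)) \<longrightarrow>
      L = \<lceil>r * sqrt (2 * ln (1 / \<epsilon>))\<rceil> \<longrightarrow>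
      prime N \<longrightarrow>
      int N \<ge> max \<lceil>N\<kappa> \<epsilon>\<rceil> (3 * L) \<longrightarrow>
      measure_pmf.prob (Hz_pmf d N)
          {\<omega>. cmod (quad d f N L r \<omega> - INT_f d f)
               \<le> C * (ln (1 / \<epsilon>) / (real_of_int L * \<sigma>) + \<epsilon>)}
        \<ge> 1 - \<sigma> \<and>
      (\<forall>t::nat. t \<ge> 7 \<and> odd t \<longrightarrow>
        measure_pmf.prob (Hz_copies_pmf d N t)
            {\<omega>. cmod (median_quad d f N L r t \<omega> - INT_f d f)
                 \<le> C * (ln (1 / \<epsilon>) / (real_of_int L * \<sigma>) + \<epsilon>)}
          \<ge> 1 - (2 * sqrt \<sigma>) ^ t \<and>
        sqrt (measure_pmf.expectation (Hz_copies_pmf d N t)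
                (\<lambda>\<omega>. (cmod (median_quad d f N L r t \<omega> - INT_f d f))\<^sup>2))
          \<le> C * (ln (1 / \<epsilon>) / (real_of_int L * \<sigma>) + \<epsilon> + (2 * sqrt \<sigma>) ^ t)))"
proof (intro exI[of _ 500] conjI allI impI, goal_cases)
  case 1
  show ?case by simp
next
  case (2 d \<kappa> N\<kappa> f n \<sigma> \<epsilon> B r L N)
  from quadrature_bounds(1)[OF 2(2-16)] show ?case .
next
  case (3 d \<kappa> N\<kappa> f n \<sigma> \<epsilon> B r L N t)
  from quadrature_bounds(2)[OF 3(2-16), of t] 3(17) show ?case by blast
next
  case (4 d \<kappa> N\<kappa> f n \<sigma> \<epsilon> B r L N t)
  have "0 \<le> (2 * sqrt \<sigma>) ^ t" using 4(8) by simp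
  with quadrature_bounds(3)[OF 4(2-16), of t] 4(17) show ?case by simp
qed

end
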